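(* Let $\mathcal{OF}$ denote the class of TM implementations that provide obstruction-free (OF) TM-progress and OF TM-liveness. There does not exist a weak disjoint-access parallel (weak DAP), strictly serializable TM implementation in $\mathcal{OF}$ that uses invisible reads.
   Context: **Model.** A transactional memory (TM) lets processes access a set of data items (t-objects) via transactions. Each transaction $T_k$ has a unique identifier $k$ and may perform t-operations, each a matching pair of an invocation and a response: $\mathrm{read}_k(X)$ returns a value in the set $V$ of values or the special value $A_k\notin V$ (abort); $\mathrm{write}_k(X,v)$, $v\in V$, returns $ok$ or $A_k$; $\mathrm{tryC}_k$ returns $C_k\notin V$ (commit) or $A_k$. The system is asynchronous shared memory with $n$ processes; a process starts a new transaction only after its previous one has committed or aborted. A TM implementation gives processes deterministic algorithms implementing t-operations by applying primitives to shared base objects, each with an initial value. A primitive is a read-modify-write (RMW) procedure $\langle g,h\rangle$: from the current state of the base object, $g$ computes the new state and $h$ the response. A primitive is trivial if it never changes the value of the base object to which it is applied, otherwise nontrivial. An event (step) of $T_k$ is an invocation or response of a t-operation of $T_k$, or a RMW primitive applied by $T_k$ to a base object together with its response; an event is (non)trivial if it applies a (non)trivial primitive. A configuration gives the value of each base object and the state of each process. An execution fragment is a finite or infinite sequence of events; an execution of implementation $M$ is an execution fragment where, starting from the initial configuration, each event is issued according to $M$ and each RMW response matches the state of the base object resulting from all preceding events. $E|k$ is the subsequence of $E$ of events of $T_k$; $T_k$ participates in $E$ if $E|k$ is non-empty; $\mathrm{txns}(E)$ is the set of participating transactions. Executions are well-formed: for every $T_k$, $E|k$ begins with an invocation of a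 t-operation, invocations in it are followed by their matching response before the next invocation, and it has no events after $A_k$ or $C_k$. The history of $E$ is its subsequence of invocations and responses of t-operations; histories $H,H'$ are equivalent if $\mathrm{txns}(H)=\mathrm{txns}(H')$ and $H|k=H'|k$ for every $T_k\in\mathrm{txns}(H)$. $\mathrm{Rset}(T_k)$ (resp. $\mathrm{Wset}(T_k)$) in $E$ is the set of t-objects $X$ for which $E$ contains an invocation of $\mathrm{read}_k(X)$ (resp. $\mathrm{write}_k(X,v)$); $\mathrm{Dset}(T_k)=\mathrm{Rset}(T_k)\cup\mathrm{Wset}(T_k)$. $T_k$ is read-only if $\mathrm{Wset}(T_k)=\emptyset$ and updating if $\mathrm{Wset}(T_k)\ne\emptyset$. Data sets are not known a priori (dynamic transactions). $T_k$ is complete in $E$ if $E|k$ ends with a response, t-complete if $E|k$ ends with $A_k$ or $C_k$, committed (aborted) if its last event is $C_k$ ($A_k$). $E$ is t-complete if all its transactions are. $T_k\prec^{RT}_E T_m$ (real-time order) if $T_k$ is t-complete in $E$ and its last event precedes the first event of $T_m$. Two transactions are concurrent in $E$ if neither precedes the other in real-time order; $E$ is t-sequential if no two transactions are concurrent. Events contend on base object $b$ if both are events on $b$ and at least one is nontrivial. $T$ is poised to apply event $e$ after $E$ if $e$ is its next enabled event. $T,T'$ concurrently contend on $b$ in $E$ if they are poised to apply contending events on $b$ after $E$. An execution fragment is step contention-free for a t-operation $op_k$ (resp. for $T_k$) if the events of $op_k$ (resp. of $T_k$) are contiguous in it. **Strict serializability.** Executions are assumed to begin with an imaginary committed transaction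 writing initial values to all t-objects. In a t-sequential history, the latest written value of $X$ for $\mathrm{read}_k(X)$ is the value of the latest preceding write to $X$ by $T_k$ itself if any, otherwise the value of the latest write to $X$ by a committed transaction preceding $T_k$. A t-sequential history is legal if every $\mathrm{read}_k(X)$ not returning $A_k$ returns the latest written value. A completion $\bar H$ of $H$ is obtained by: for every incomplete t-operation $op_k$, if it is a read or write, inserting $A_k$ somewhere after its invocation, and if it is $\mathrm{tryC}_k$, inserting $C_k$ or $A_k$ somewhere after the last event of $T_k$; and for every complete but not t-complete $T_k$, inserting $\mathrm{tryC}_k\cdot A_k$ somewhere after the last event of $T_k$. A finite history $H$ is strictly serializable if there is a legal t-complete t-sequential history $S$ such that (1) $T_k\prec^{RT}_H T_m$ implies $T_k$ precedes $T_m$ in $S$, for any $T_k,T_m\in\mathrm{txns}(H)$ (both in $S$), and (2) $S$ is equivalent to the subsequence of some completion $\bar H$ of $H$ reduced to the transactions committed in $\bar H$. $M$ is strictly serializable if the history of each of its finite executions is. **OF TM-liveness.** For every finite execution $E$ of $M$ and every $T_k$ that applies the invocation of a t-operation $op_k$ immediately after $E$, the finite step contention-free extension for $op_k$ contains a matching response. **OF TM-progress.** For every execution $E$ of $M$, if some $T_k\in\mathrm{txns}(E)$ returns $A_k$ in $E$, then $E$ is not step contention-free for $T_k$. **Weak DAP.** $\tau_E(T_i,T_j)$ is the set of transactions (including $T_i,T_j$) concurrent to at least one of $T_i,T_j$ in $E$. $G(T_i,T_j,E)$ is the undirected graph with vertex set $\bigcup_{T\in\tau_E(T_i,T_j)}\mathrm{Dset}(T)$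 and an edge between $X$ and $Y$ iff some $T\in\tau_E(T_i,T_j)$ has $\{X,Y\}\subseteq\mathrm{Dset}(T)$. $T_i,T_j$ are disjoint-access in $E$ if there is no path between a t-object in $\mathrm{Dset}(T_i)$ and one in $\mathrm{Dset}(T_j)$ in $G(T_i,T_j,E)$. $M$ is weak DAP if, for all executions $E$ of $M$, $T_i$ and $T_j$ concurrently contend on the same base object in $E$ only if they are not disjoint-access in $E$ or $\mathrm{Dset}(T_i)\cap\mathrm{Dset}(T_j)\neq\emptyset$. **Invisible reads.** $M$ uses invisible reads if for every execution $E$ of $M$: (i) for every read-only $T_k\in\mathrm{txns}(E)$, no event of $E|k$ is nontrivial; (ii) for every updating $T_k\in\mathrm{txns}(E)$ with $\mathrm{Rset}(T_k)\ne\emptyset$ there is an execution $E'$ of $M$ such that $\mathrm{Rset}(T_k)=\emptyset$ in $E'$; $\mathrm{txns}(E)=\mathrm{txns}(E')$ and $E|m=E'|m$ for all $T_m\in\mathrm{txns}(E)\setminus\{T_k\}$; and for any two step contention-free transactions $T_i,T_j\in\mathrm{txns}(E)$, if the last event of $T_i$ precedes the first event of $T_j$ in $E$, then the same holds in $E'$.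
   Formalization: Invisible reads (ii) additionally requires that Wset(T_k) in E' be contained in Wset(T_k) in E (without this the claim is false: reads could be replaced by writes of the values read); at least three processes, two t-objects and two values are assumed. *)

theory Defs
  imports "HOL-Library.Infinite_Set" "HOL-Library.Cardinality"
begin

section \<open>Transactions, t-operations and events\<close>

text \<open>
  Type variables: \<open>'p\<close> processes, \<open>'x\<close> t-objects, \<open>'v\<close> the value set V, \<open>'b\<close> base objects,
  \<open>'s\<close> values of base objects, \<open>'r\<close> responses of primitives, \<open>'l\<close> local states of processes.

  A transaction identifier carries the process that executes the transaction, so identifiers are
  unique across processes and all events of a transaction are issued by one process.
\<close>

type_synonym 'p txn = "'p \<times> nat"

abbreviation process_of :: "'p txn \<Rightarrow> 'p" where "process_of \<equiv> fst"

datatype ('x, 'v) operation = Read 'x | Write 'x 'v | TryC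

datatype 'v response = Val 'v | Ok | Commit | Abort

fun matches :: "('x, 'v) operation \<Rightarrow> 'v response \<Rightarrow> bool" where
  "matches (Read X) r \<longleftrightarrow> (\<exists>v. r = Val v) \<or> r = Abort"
| "matches (Write X v) r \<longleftrightarrow> r = Ok \<or> r = Abort"
| "matches TryC r \<longleftrightarrow> r = Commit \<or> r = Abort"

text \<open>\<open>Rmw b g h r\<close>: the primitive \<open>\<langle>g,h\<rangle>\<close> is applied to \<open>b\<close> and its response is \<open>r\<close>.\<close>

datatype ('x, 'v, 'b, 's, 'r) action =
    Inv "('x, 'v) operation"
  | Resp "'v response"
  | Rmw 'b "'s \<Rightarrow> 's" "'s \<Rightarrow> 'r" 'r

datatype ('p, 'x, 'v, 'b, 's, 'r) event =
  Event (txn: "'p txn") (act: "('x, 'v, 'b, 's, 'r) action")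

definition trivial_prim :: "('s \<Rightarrow> 's) \<Rightarrow> bool" where
  "trivial_prim g \<longleftrightarrow> (\<forall>s. g s = s)"

definition nontrivial :: "('p, 'x, 'v, 'b, 's, 'r) event \<Rightarrow> bool" where
  "nontrivial e \<longleftrightarrow> (\<exists>b g h r. act e = Rmw b g h r \<and> \<not> trivial_prim g)"

definition on_object :: "'b \<Rightarrow> ('p, 'x, 'v, 'b, 's, 'r) event \<Rightarrow> bool" where
  "on_object b e \<longleftrightarrow> (\<exists>g h r. act e = Rmw b g h r)"

definition contend_on ::
    "'b \<Rightarrow> ('p, 'x, 'v, 'b, 's, 'r) event \<Rightarrow> ('p, 'x, 'v, 'b, 's, 'r) event \<Rightarrow> bool" where
  "contend_on b e e' \<longleftrightarrow> on_object b e \<and> on_object b e' \<and> (nontrivial e \<or> nontrivial e')"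


section \<open>Execution fragments: finite or infinite sequences\<close>

datatype 'e seq = FinSeq "'e list" | InfSeq "nat \<Rightarrow> 'e"

fun indices :: "'e seq \<Rightarrow> nat set" where
  "indices (FinSeq es) = {..<length es}"
| "indices (InfSeq f) = UNIV"

fun at :: "'e seq \<Rightarrow> nat \<Rightarrow> 'e" where
  "at (FinSeq es) i = es ! i"
| "at (InfSeq f) i = f i"

fun prefix_of :: "nat \<Rightarrow> 'e seq \<Rightarrow> 'e list" where
  "prefix_of n (FinSeq es) = take n es"
| "prefix_of n (InfSeq f) = map f [0..<n]"

definition pos :: "('p, 'x, 'v, 'b, 's, 'r) event seq \<Rightarrow> 'p txn \<Rightarrow> nat set" where
  "pos E k = {i \<in> indices E. txn (at E i) = k}"

definition txns :: "('p, 'x, 'v, 'b, 's, 'r) event seq \<Rightarrow> 'p txn set" where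
  "txns E = {k. pos E k \<noteq> {}}"

text \<open>The subsequence \<open>E|k\<close>, for finite sequences and in general.\<close>

definition sublist_of ::
    "('p, 'x, 'v, 'b, 's, 'r) event list \<Rightarrow> 'p txn \<Rightarrow> ('p, 'x, 'v, 'b, 's, 'r) event list" where
  "sublist_of E k = filter (\<lambda>e. txn e = k) E"

fun proj ::
    "('p, 'x, 'v, 'b, 's, 'r) event seq \<Rightarrow> 'p txn \<Rightarrow> ('p, 'x, 'v, 'b, 's, 'r) event seq" where
  "proj (FinSeq es) k = FinSeq (sublist_of es k)"
| "proj (InfSeq f) k =
    (let S = pos (InfSeq f) k in
     if finite S then FinSeq (map f (sorted_list_of_set S)) else InfSeq (\<lambda>n. f (enumerate S n)))"

definition Rset :: "('p, 'x, 'v, 'b, 's, 'r) event seq \<Rightarrow> 'p txn \<Rightarrow> 'x set" where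
  "Rset E k = {X. \<exists>i\<in>pos E k. act (at E i) = Inv (Read X)}"

definition Wset :: "('p, 'x, 'v, 'b, 's, 'r) event seq \<Rightarrow> 'p txn \<Rightarrow> 'x set" where
  "Wset E k = {X. \<exists>i\<in>pos E k. \<exists>v. act (at E i) = Inv (Write X v)}"

definition Dset :: "('p, 'x, 'v, 'b, 's, 'r) event seq \<Rightarrow> 'p txn \<Rightarrow> 'x set" where
  "Dset E k = Rset E k \<union> Wset E k"

definition read_only :: "('p, 'x, 'v, 'b, 's, 'r) event seq \<Rightarrow> 'p txn \<Rightarrow> bool" where
  "read_only E k \<longleftrightarrow> Wset E k = {}"

definition updating :: "('p, 'x, 'v, 'b, 's, 'r) event seq \<Rightarrow> 'p txn \<Rightarrow> bool" where
  "updating E k \<longleftrightarrow> Wset E k \<noteq> {}"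

definition ends_with ::
    "('p, 'x, 'v, 'b, 's, 'r) event seq \<Rightarrow> 'p txn \<Rightarrow> 'v response \<Rightarrow> bool" where
  "ends_with E k r \<longleftrightarrow> (\<exists>i\<in>pos E k. act (at E i) = Resp r \<and> (\<forall>j\<in>pos E k. j \<le> i))"

definition committed :: "('p, 'x, 'v, 'b, 's, 'r) event seq \<Rightarrow> 'p txn \<Rightarrow> bool" where
  "committed E k \<longleftrightarrow> ends_with E k Commit"

definition aborted :: "('p, 'x, 'v, 'b, 's, 'r) event seq \<Rightarrow> 'p txn \<Rightarrow> bool" where
  "aborted E k \<longleftrightarrow> ends_with E k Abort"

definition t_complete :: "('p, 'x, 'v, 'b, 's, 'r) event seq \<Rightarrow> 'p txn \<Rightarrow> bool" where
  "t_complete E k \<longleftrightarrow> committed E k \<or> aborted E k"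

definition all_before ::
    "('p, 'x, 'v, 'b, 's, 'r) event seq \<Rightarrow> 'p txn \<Rightarrow> 'p txn \<Rightarrow> bool" where
  "all_before E k m \<longleftrightarrow> (\<forall>i\<in>pos E k. \<forall>j\<in>pos E m. i < j)"

definition rt_prec :: "('p, 'x, 'v, 'b, 's, 'r) event seq \<Rightarrow> 'p txn \<Rightarrow> 'p txn \<Rightarrow> bool" where
  "rt_prec E k m \<longleftrightarrow> k \<in> txns E \<and> m \<in> txns E \<and> t_complete E k \<and> all_before E k m"

definition concurrent :: "('p, 'x, 'v, 'b, 's, 'r) event seq \<Rightarrow> 'p txn \<Rightarrow> 'p txn \<Rightarrow> bool" where
  "concurrent E k m \<longleftrightarrow> k \<in> txns E \<and> m \<in> txns E \<and> \<not> rt_prec E k m \<and> \<not> rt_prec E m k"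

definition t_sequential :: "('p, 'x, 'v, 'b, 's, 'r) event seq \<Rightarrow> bool" where
  "t_sequential E \<longleftrightarrow> (\<forall>k m. k \<noteq> m \<longrightarrow> \<not> concurrent E k m)"

definition step_contention_free :: "('p, 'x, 'v, 'b, 's, 'r) event seq \<Rightarrow> 'p txn \<Rightarrow> bool" where
  "step_contention_free E k \<longleftrightarrow>
    (\<forall>i j l. i \<in> pos E k \<and> l \<in> pos E k \<and> i < j \<and> j < l \<longrightarrow> j \<in> pos E k)"

definition history ::
    "('p, 'x, 'v, 'b, 's, 'r) event list \<Rightarrow> ('p, 'x, 'v, 'b, 's, 'r) event list" where
  "history E = filter (\<lambda>e. \<forall>b g h r. act e \<noteq> Rmw b g h r) E"


section \<open>TM implementations and their executions\<close>

datatype ('v, 'b, 's, 'r) step = Apply 'b "'s \<Rightarrow> 's" "'s \<Rightarrow> 'r" | Return "'v response"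

text \<open>
  A process is a deterministic automaton: while one of its t-operations is pending, its local state
  determines the next step via \<open>next_step\<close>; \<open>update\<close> is the effect of its own events (invocations
  of t-operations, primitives with their responses, responses of t-operations) on that state.
\<close>

record ('p, 'x, 'v, 'b, 's, 'r, 'l) tm =
  init_val :: "'x \<Rightarrow> 'v"
  init_base :: "'b \<Rightarrow> 's"
  init_state :: "'p \<Rightarrow> 'l"
  next_step :: "'p \<Rightarrow> 'l \<Rightarrow> ('v, 'b, 's, 'r) step"
  update :: "'p \<Rightarrow> 'l \<Rightarrow> ('p, 'x, 'v, 'b, 's, 'r) event \<Rightarrow> 'l"

fun update_base ::
    "('p, 'x, 'v, 'b, 's, 'r) event \<Rightarrow> ('b \<Rightarrow> 's) \<Rightarrow> ('b \<Rightarrow> 's)" where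
  "update_base (Event k (Rmw b g h r)) mem = mem(b := g (mem b))"
| "update_base (Event k (Inv op)) mem = mem"
| "update_base (Event k (Resp r)) mem = mem"

definition base_after ::
    "('p, 'x, 'v, 'b, 's, 'r, 'l) tm \<Rightarrow> ('p, 'x, 'v, 'b, 's, 'r) event list \<Rightarrow> 'b \<Rightarrow> 's" where
  "base_after M E = fold update_base E (init_base M)"

definition state_after ::
    "('p, 'x, 'v, 'b, 's, 'r, 'l) tm \<Rightarrow> ('p, 'x, 'v, 'b, 's, 'r) event list \<Rightarrow> 'p \<Rightarrow> 'l" where
  "state_after M E p =
    fold (\<lambda>e l. update M p l e) (filter (\<lambda>e. process_of (txn e) = p) E) (init_state M p)"

text \<open>The t-operation of \<open>T\<^sub>k\<close> that is invoked but has no response yet, if any.\<close>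

definition pending ::
    "('p, 'x, 'v, 'b, 's, 'r) event list \<Rightarrow> 'p txn \<Rightarrow> ('x, 'v) operation \<Rightarrow> bool" where
  "pending E k op \<longleftrightarrow>
    (let H = history (sublist_of E k) in H \<noteq> [] \<and> act (last H) = Inv op)"

definition may_invoke :: "('p, 'x, 'v, 'b, 's, 'r) event list \<Rightarrow> 'p txn \<Rightarrow> bool" where
  "may_invoke E k \<longleftrightarrow>
    (\<nexists>op. pending E k op) \<and> \<not> t_complete (FinSeq E) k \<and>
    (\<forall>m\<in>txns (FinSeq E). m \<noteq> k \<and> process_of m = process_of k \<longrightarrow> t_complete (FinSeq E) m)"

fun enabled ::
    "('p, 'x, 'v, 'b, 's, 'r, 'l) tm \<Rightarrow> ('p, 'x, 'v, 'b, 's, 'r) event list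
      \<Rightarrow> ('p, 'x, 'v, 'b, 's, 'r) event \<Rightarrow> bool" where
  "enabled M E (Event k (Inv op)) \<longleftrightarrow> may_invoke E k"
| "enabled M E (Event k (Resp r)) \<longleftrightarrow>
    (\<exists>op. pending E k op) \<and>
    next_step M (process_of k) (state_after M E (process_of k)) = Return r"
| "enabled M E (Event k (Rmw b g h r)) \<longleftrightarrow>
    (\<exists>op. pending E k op) \<and>
    next_step M (process_of k) (state_after M E (process_of k)) = Apply b g h \<and>
    r = h (base_after M E b)"

inductive fin_execution ::
    "('p, 'x, 'v, 'b, 's, 'r, 'l) tm \<Rightarrow> ('p, 'x, 'v, 'b, 's, 'r) event list \<Rightarrow> bool"
  for M where
  empty: "fin_execution M []"
| snoc: "fin_execution M E \<Longrightarrow> enabled M E e \<Longrightarrow> fin_execution M (E @ [e])"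

definition execution ::
    "('p, 'x, 'v, 'b, 's, 'r, 'l) tm \<Rightarrow> ('p, 'x, 'v, 'b, 's, 'r) event seq \<Rightarrow> bool" where
  "execution M E \<longleftrightarrow> (\<forall>n. fin_execution M (prefix_of n E))"

text \<open>
  The remaining well-formedness conditions on executions are built into \<open>enabled\<close>; that responses
  match their invocations is a requirement on the implementation.
\<close>

definition tm_implementation :: "('p, 'x, 'v, 'b, 's, 'r, 'l) tm \<Rightarrow> bool" where
  "tm_implementation M \<longleftrightarrow>
    (\<forall>E k op r. fin_execution M E \<and> pending E k op \<and> enabled M E (Event k (Resp r))
      \<longrightarrow> matches op r)"


section \<open>Strict serializability\<close>

fun written_value :: "'x \<Rightarrow> ('x, 'v, 'b, 's, 'r) action \<Rightarrow> 'v option" where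
  "written_value X (Inv (Write Y v)) = (if X = Y then Some v else None)"
| "written_value X _ = None"

definition writes_to :: "'x \<Rightarrow> ('p, 'x, 'v, 'b, 's, 'r) event list \<Rightarrow> 'v list" where
  "writes_to X es = List.map_filter (\<lambda>e. written_value X (act e)) es"

text \<open>
  The latest written value of \<open>X\<close> for a read of \<open>T\<^sub>k\<close> invoked at position \<open>i\<close> of \<open>S\<close>. The imaginary
  initial transaction is represented by its values \<open>init\<close>.
\<close>

definition latest_written ::
    "('x \<Rightarrow> 'v) \<Rightarrow> ('p, 'x, 'v, 'b, 's, 'r) event list \<Rightarrow> nat \<Rightarrow> 'p txn \<Rightarrow> 'x \<Rightarrow> 'v" where
  "latest_written init S i k X =
    (let own = writes_to X (sublist_of (take i S) k);
         prev = writes_to X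
           (filter (\<lambda>e. committed (FinSeq S) (txn e) \<and> rt_prec (FinSeq S) (txn e) k) S)
     in if own \<noteq> [] then last own else if prev \<noteq> [] then last prev else init X)"

definition legal :: "('x \<Rightarrow> 'v) \<Rightarrow> ('p, 'x, 'v, 'b, 's, 'r) event list \<Rightarrow> bool" where
  "legal init S \<longleftrightarrow>
    (\<forall>i j k X v. i < j \<and> j < length S \<and>
       S ! i = Event k (Inv (Read X)) \<and> S ! j = Event k (Resp (Val v)) \<and>
       (\<forall>l. i < l \<and> l < j \<longrightarrow> txn (S ! l) \<noteq> k)
       \<longrightarrow> v = latest_written init S i k X)"

definition completing_events ::
    "('p, 'x, 'v, 'b, 's, 'r) event list \<Rightarrow> 'p txn \<Rightarrow> ('p, 'x, 'v, 'b, 's, 'r) event list set" where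
  "completing_events H k =
    (if sublist_of H k = [] then {} else
     case act (last (sublist_of H k)) of
       Inv TryC \<Rightarrow> {[Event k (Resp Commit)], [Event k (Resp Abort)]}
     | Inv _ \<Rightarrow> {[Event k (Resp Abort)]}
     | Resp r \<Rightarrow> (if r = Commit \<or> r = Abort then {}
                  else {[Event k (Inv TryC), Event k (Resp Abort)]})
     | Rmw _ _ _ _ \<Rightarrow> {})"

definition completion_step ::
    "('p, 'x, 'v, 'b, 's, 'r) event list \<Rightarrow> ('p, 'x, 'v, 'b, 's, 'r) event list \<Rightarrow> bool" where
  "completion_step H H' \<longleftrightarrow>
    (\<exists>k as bs cs. H = as @ bs \<and> (\<forall>e\<in>set bs. txn e \<noteq> k) \<and>
       cs \<in> completing_events H k \<and> H' = as @ cs @ bs)"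

definition completion ::
    "('p, 'x, 'v, 'b, 's, 'r) event list \<Rightarrow> ('p, 'x, 'v, 'b, 's, 'r) event list \<Rightarrow> bool" where
  "completion H H' \<longleftrightarrow>
    completion_step\<^sup>*\<^sup>* H H' \<and> (\<forall>k\<in>txns (FinSeq H'). t_complete (FinSeq H') k)"

definition equivalent ::
    "('p, 'x, 'v, 'b, 's, 'r) event list \<Rightarrow> ('p, 'x, 'v, 'b, 's, 'r) event list \<Rightarrow> bool" where
  "equivalent H H' \<longleftrightarrow>
    txns (FinSeq H) = txns (FinSeq H') \<and>
    (\<forall>k\<in>txns (FinSeq H). sublist_of H k = sublist_of H' k)"

definition strictly_serializable_history ::
    "('x \<Rightarrow> 'v) \<Rightarrow> ('p, 'x, 'v, 'b, 's, 'r) event list \<Rightarrow> bool" where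
  "strictly_serializable_history init H \<longleftrightarrow>
    (\<exists>S H'. legal init S \<and> t_sequential (FinSeq S) \<and>
       (\<forall>k\<in>txns (FinSeq S). t_complete (FinSeq S) k) \<and>
       (\<forall>k\<in>txns (FinSeq S). \<forall>m\<in>txns (FinSeq S).
          rt_prec (FinSeq H) k m \<longrightarrow> rt_prec (FinSeq S) k m) \<and>
       completion H H' \<and>
       equivalent S (filter (\<lambda>e. committed (FinSeq H') (txn e)) H'))"

definition strictly_serializable :: "('p, 'x, 'v, 'b, 's, 'r, 'l) tm \<Rightarrow> bool" where
  "strictly_serializable M \<longleftrightarrow>
    (\<forall>E. fin_execution M E \<longrightarrow> strictly_serializable_history (init_val M) (history E))"


section \<open>Obstruction-free TM-liveness and TM-progress\<close>

definition OF_liveness :: "('p, 'x, 'v, 'b, 's, 'r, 'l) tm \<Rightarrow> bool" where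
  "OF_liveness M \<longleftrightarrow>
    (\<forall>E k op. fin_execution M (E @ [Event k (Inv op)]) \<longrightarrow>
      (\<exists>F r. fin_execution M (E @ [Event k (Inv op)] @ F @ [Event k (Resp r)]) \<and>
         matches op r \<and>
         (\<forall>e\<in>set F. txn e = k \<and> (\<exists>b g h r'. act e = Rmw b g h r'))))"

definition OF_progress :: "('p, 'x, 'v, 'b, 's, 'r, 'l) tm \<Rightarrow> bool" where
  "OF_progress M \<longleftrightarrow>
    (\<forall>E k. execution M E \<and> (\<exists>i\<in>pos E k. act (at E i) = Resp Abort)
      \<longrightarrow> \<not> step_contention_free E k)"

definition OF_class :: "('p, 'x, 'v, 'b, 's, 'r, 'l) tm set" where
  "OF_class = {M. tm_implementation M \<and> OF_progress M \<and> OF_liveness M}"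


section \<open>Weak disjoint-access parallelism\<close>

definition poised ::
    "('p, 'x, 'v, 'b, 's, 'r, 'l) tm \<Rightarrow> ('p, 'x, 'v, 'b, 's, 'r) event list \<Rightarrow> 'p txn
      \<Rightarrow> ('p, 'x, 'v, 'b, 's, 'r) event \<Rightarrow> bool" where
  "poised M E k e \<longleftrightarrow> txn e = k \<and> enabled M E e"

definition concurrently_contend ::
    "('p, 'x, 'v, 'b, 's, 'r, 'l) tm \<Rightarrow> ('p, 'x, 'v, 'b, 's, 'r) event list
      \<Rightarrow> 'p txn \<Rightarrow> 'p txn \<Rightarrow> 'b \<Rightarrow> bool" where
  "concurrently_contend M E i j b \<longleftrightarrow>
    (\<exists>e e'. poised M E i e \<and> poised M E j e' \<and> contend_on b e e')"

definition tau ::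
    "('p, 'x, 'v, 'b, 's, 'r) event seq \<Rightarrow> 'p txn \<Rightarrow> 'p txn \<Rightarrow> 'p txn set" where
  "tau E i j = {i, j} \<union> {k. concurrent E k i \<or> concurrent E k j}"

text \<open>
  The graph \<open>G(T\<^sub>i,T\<^sub>j,E)\<close> is given by its edge relation. Its vertex set, the union of the data sets
  of \<open>tau E i j\<close>, is the field of that relation.
\<close>

definition dap_edges ::
    "('p, 'x, 'v, 'b, 's, 'r) event seq \<Rightarrow> 'p txn \<Rightarrow> 'p txn \<Rightarrow> ('x \<times> 'x) set" where
  "dap_edges E i j = {(X, Y). \<exists>k\<in>tau E i j. {X, Y} \<subseteq> Dset E k}"

definition disjoint_access ::
    "('p, 'x, 'v, 'b, 's, 'r) event seq \<Rightarrow> 'p txn \<Rightarrow> 'p txn \<Rightarrow> bool" where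
  "disjoint_access E i j \<longleftrightarrow>
    \<not> (\<exists>X\<in>Dset E i. \<exists>Y\<in>Dset E j. (X, Y) \<in> (dap_edges E i j)\<^sup>*)"

definition weak_DAP :: "('p, 'x, 'v, 'b, 's, 'r, 'l) tm \<Rightarrow> bool" where
  "weak_DAP M \<longleftrightarrow>
    (\<forall>E i j b. fin_execution M E \<and> i \<noteq> j \<and> concurrently_contend M E i j b \<longrightarrow>
       \<not> disjoint_access (FinSeq E) i j \<or> Dset (FinSeq E) i \<inter> Dset (FinSeq E) j \<noteq> {})"


section \<open>Invisible reads\<close>

text \<open>
  In the second clause \<open>E'\<close> contains the same transaction \<open>T\<^sub>k\<close> with its reads removed: its read set
  becomes empty and its write set does not grow. If \<open>T\<^sub>k\<close> could write to additional t-objects in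
  \<open>E'\<close>, then reads of updating transactions that lock the t-objects read, exactly as writes do,
  would count as invisible, since in \<open>E'\<close> they could be replaced by writes of the values read.
\<close>

definition invisible_reads :: "('p, 'x, 'v, 'b, 's, 'r, 'l) tm \<Rightarrow> bool" where
  "invisible_reads M \<longleftrightarrow> (\<forall>E. execution M E \<longrightarrow>
    (\<forall>k\<in>txns E. read_only E k \<longrightarrow> (\<forall>i\<in>pos E k. \<not> nontrivial (at E i))) \<and>
    (\<forall>k\<in>txns E. updating E k \<and> Rset E k \<noteq> {} \<longrightarrow>
      (\<exists>E'. execution M E' \<and> Rset E' k = {} \<and> Wset E' k \<subseteq> Wset E k \<and>
        txns E = txns E' \<and> (\<forall>m\<in>txns E - {k}. proj E m = proj E' m) \<and>
        (\<forall>i\<in>txns E. \<forall>j\<in>txns E.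
          step_contention_free E i \<and> step_contention_free E j \<and> all_before E i j
            \<longrightarrow> all_before E' i j))))"

end

theory Submission
  imports Defs
begin

text \<open>
  Let \<open>T0\<close> run alone, reading \<open>Z\<close>, writing a new value to \<open>X\<close> and committing. After each prefix of
  this run let \<open>T3\<close> overwrite \<open>Z\<close> and commit, and then let \<open>T2\<close> read \<open>X\<close>. Some step \<open>e\<close> of \<open>T0\<close>
  switches the value read from the initial to the new one. Once its reads are hidden, \<open>T0\<close> is
  disjoint-access from \<open>T3\<close>, so \<open>T3\<close> always takes the steps that it would take from the initial
  configuration. The step \<open>e\<close> must change a base object \<open>b\<close> accessed by \<open>T2\<close>; after hiding the
  reads of \<open>T0\<close> also \<open>T3\<close> and \<open>T2\<close> are disjoint-access, so \<open>T3\<close> does not change \<open>b\<close>. Hence \<open>e\<close> may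
  be postponed until after \<open>T3\<close> and a further reader \<open>T1\<close> of \<open>X\<close>, without \<open>T2\<close> noticing. In the
  resulting execution \<open>T1\<close> still reads the initial value of \<open>X\<close> and \<open>T2\<close> the new one. So \<open>T0\<close>, which
  read the initial value of \<open>Z\<close>, is serialized before \<open>T3\<close>, which precedes \<open>T1\<close> in real time, although
  \<open>T1\<close> misses the write of \<open>T0\<close>. Running \<open>T1\<close> on the process of \<open>T3\<close> makes three processes suffice.
\<close>

section \<open>Finite sequences of events\<close>

lemma pos_FinSeq: "i \<in> pos (FinSeq es) k \<longleftrightarrow> i < length es \<and> txn (es ! i) = k"
  by (auto simp: pos_def)

lemma txns_FinSeq: "txns (FinSeq es) = txn ` set es"
proof -
  have "k \<in> txns (FinSeq es) \<longleftrightarrow> k \<in> txn ` set es" for k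
    by (simp add: txns_def set_eq_iff pos_FinSeq image_iff Bex_def in_set_conv_nth) metis
  then show ?thesis by blast
qed

lemma pos_act_iff: "(\<exists>i\<in>pos (FinSeq es) k. act (es ! i) = a) \<longleftrightarrow> Event k a \<in> set es"
proof
  assume "\<exists>i\<in>pos (FinSeq es) k. act (es ! i) = a"
  then obtain i where i: "i < length es" "txn (es ! i) = k" "act (es ! i) = a"
    by (auto simp: pos_FinSeq)
  then have "es ! i = Event k a" by (cases "es ! i") simp
  then show "Event k a \<in> set es" using i(1) nth_mem by metis
next
  assume "Event k a \<in> set es"
  then obtain i where "i < length es" "es ! i = Event k a" by (auto simp: in_set_conv_nth)
  then show "\<exists>i\<in>pos (FinSeq es) k. act (es ! i) = a"
    by (intro bexI[of _ i]) (auto simp: pos_FinSeq)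
qed

lemma Rset_FinSeq: "Rset (FinSeq es) k = {X. Event k (Inv (Read X)) \<in> set es}"
proof -
  have "(\<exists>i\<in>pos (FinSeq es) k. act (es ! i) = a) \<longleftrightarrow> Event k a \<in> set es" for a
    by (rule pos_act_iff)
  then show ?thesis by (simp add: Rset_def)
qed

lemma Wset_FinSeq: "Wset (FinSeq es) k = {X. \<exists>v. Event k (Inv (Write X v)) \<in> set es}"
proof -
  have "Wset (FinSeq es) k = {X. \<exists>v. \<exists>i\<in>pos (FinSeq es) k. act (es ! i) = Inv (Write X v)}"
    unfolding Wset_def by auto
  then show ?thesis by (simp add: pos_act_iff)
qed

lemma sublist_of_append [simp]: "sublist_of (A @ B) k = sublist_of A k @ sublist_of B k"
  by (simp add: sublist_of_def)

lemma sublist_of_Nil [simp]: "sublist_of [] k = []"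
  by (simp add: sublist_of_def)

lemma sublist_of_Cons [simp]:
  "sublist_of (e # B) k = (if txn e = k then e # sublist_of B k else sublist_of B k)"
  by (simp add: sublist_of_def)

lemma set_sublist_of [simp]: "set (sublist_of E k) = {e \<in> set E. txn e = k}"
  by (auto simp: sublist_of_def)

lemma sublist_of_same: "\<forall>e\<in>set E. txn e = k \<Longrightarrow> sublist_of E k = E"
  by (simp add: sublist_of_def)

lemma sublist_of_other: "\<forall>e\<in>set E. txn e \<noteq> k \<Longrightarrow> sublist_of E k = []"
  by (simp add: sublist_of_def)

lemma sublist_of_eq_Nil_iff: "sublist_of E k = [] \<longleftrightarrow> k \<notin> txn ` set E"
  by (auto simp: sublist_of_def filter_empty_conv)

lemma history_append [simp]: "history (A @ B) = history A @ history B"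
  by (simp add: history_def)

lemma set_history_subset: "set (history E) \<subseteq> set E"
  by (auto simp: history_def)

text \<open>Positions are traded for the last element of the projection, so that being t-complete or
  committed becomes invariant under equality of projections.\<close>

lemma ends_with_FinSeq:
  "ends_with (FinSeq es) k r \<longleftrightarrow>
    sublist_of es k \<noteq> [] \<and> act (last (sublist_of es k)) = Resp r"
proof (induction es rule: rev_induct)
  case Nil
  show ?case by (simp add: ends_with_def pos_def)
next
  case (snoc e es)
  show ?case
  proof (cases "txn e = k")
    case True
    have "i \<in> pos (FinSeq (es @ [e])) k \<Longrightarrow> i \<le> length es" for i
      by (auto simp: pos_FinSeq)
    moreover have "length es \<in> pos (FinSeq (es @ [e])) k"
      using True by (auto simp: pos_FinSeq)
    ultimately have "ends_with (FinSeq (es @ [e])) k r \<longleftrightarrow> act (at (FinSeq (es @ [e])) (length es)) = Resp r"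
      unfolding ends_with_def by (metis order_antisym)
    then show ?thesis using True by simp
  next
    case False
    then have "pos (FinSeq (es @ [e])) k = pos (FinSeq es) k"
      by (auto simp: pos_FinSeq nth_append less_Suc_eq)
    moreover have "i \<in> pos (FinSeq es) k \<Longrightarrow> at (FinSeq (es @ [e])) i = at (FinSeq es) i" for i
      by (auto simp: pos_FinSeq nth_append)
    ultimately have "ends_with (FinSeq (es @ [e])) k r = ends_with (FinSeq es) k r"
      unfolding ends_with_def by auto
    then show ?thesis using snoc False by simp
  qed
qed

lemma t_complete_FinSeq:
  "t_complete (FinSeq es) k \<longleftrightarrow> sublist_of es k \<noteq> [] \<and>
    (act (last (sublist_of es k)) = Resp Commit \<or> act (last (sublist_of es k)) = Resp Abort)"
  by (auto simp: t_complete_def committed_def aborted_def ends_with_FinSeq)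

lemma t_complete_cong:
  "sublist_of E k = sublist_of E' k \<Longrightarrow> t_complete (FinSeq E) k = t_complete (FinSeq E') k"
  by (simp add: t_complete_FinSeq)

lemma committed_FinSeq:
  "committed (FinSeq es) k \<longleftrightarrow> sublist_of es k \<noteq> [] \<and> act (last (sublist_of es k)) = Resp Commit"
  by (simp add: committed_def ends_with_FinSeq)

lemma all_before_append:
  assumes "\<forall>e\<in>set A. txn e \<noteq> m" "\<forall>e\<in>set B. txn e \<noteq> k"
  shows "all_before (FinSeq (A @ B)) k m"
  unfolding all_before_def
proof (intro ballI)
  fix i j assume ij: "i \<in> pos (FinSeq (A @ B)) k" "j \<in> pos (FinSeq (A @ B)) m"
  have "i < length A"
  proof (rule ccontr)
    assume "\<not> i < length A"
    then have "(A @ B) ! i \<in> set B" using ij(1) by (auto simp: pos_FinSeq nth_append)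
    then show False using ij(1) assms(2) by (auto simp: pos_FinSeq)
  qed
  moreover have "\<not> j < length A"
  proof
    assume "j < length A"
    then have "(A @ B) ! j \<in> set A" by (simp add: nth_append)
    then show False using ij(2) assms(1) by (auto simp: pos_FinSeq)
  qed
  ultimately show "i < j" by simp
qed

lemma step_contention_free_block:
  assumes "\<forall>e\<in>set A. txn e \<noteq> k" "\<forall>e\<in>set B. txn e = k" "\<forall>e\<in>set C. txn e \<noteq> k"
  shows "step_contention_free (FinSeq (A @ B @ C)) k"
proof -
  have *: "i \<in> pos (FinSeq (A @ B @ C)) k \<longleftrightarrow> length A \<le> i \<and> i < length A + length B" for i
  proof -
    consider "i < length A" | "length A \<le> i" "i < length A + length B"
      | "length A + length B \<le> i" "i < length (A @ B @ C)" | "i \<ge> length (A @ B @ C)"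
      by linarith
    then show ?thesis
    proof cases
      case 1
      then show ?thesis using assms(1) nth_mem[of i A] by (auto simp: pos_FinSeq nth_append)
    next
      case 2
      then show ?thesis using assms(2) nth_mem[of "i - length A" B]
        by (auto simp: pos_FinSeq nth_append)
    next
      case 3
      then show ?thesis using assms(3) nth_mem[of "i - length A - length B" C]
        by (auto simp: pos_FinSeq nth_append)
    next
      case 4
      then show ?thesis by (auto simp: pos_FinSeq)
    qed
  qed
  show ?thesis unfolding step_contention_free_def * by auto
qed

text \<open>Downward closure along positions means that no event violating \<open>P\<close> comes
  before one satisfying it. This turns order statements about transactions into a concatenation of
  blocks.\<close>

lemma split_by_order:
  assumes "\<And>i j. i < j \<Longrightarrow> j < length es \<Longrightarrow> P (es ! j) \<Longrightarrow> P (es ! i)"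
  shows "es = filter P es @ filter (\<lambda>e. \<not> P e) es"
  using assms
proof (induction es)
  case (Cons a es)
  have IH: "es = filter P es @ filter (\<lambda>e. \<not> P e) es"
  proof (rule Cons.IH)
    fix i j assume "i < j" "j < length es" "P (es ! j)"
    then show "P (es ! i)" using Cons.prems[of "Suc i" "Suc j"] by simp
  qed
  show ?case
  proof (cases "P a")
    case True
    then show ?thesis using IH by simp
  next
    case False
    have "\<not> P e" if e: "e \<in> set es" for e
    proof -
      obtain j where "j < length es" "es ! j = e" using e by (auto simp: in_set_conv_nth)
      then show ?thesis using Cons.prems[of 0 "Suc j"] False by auto
    qed
    then have "filter P es = []" by (simp add: filter_empty_conv)
    then show ?thesis using IH False by simp
  qed
qed simp

text \<open>An infinite sequence could only arise if one of its finitely many transactions took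
  infinitely many steps.\<close>

lemma finite_projections_FinSeq:
  assumes "finite (txns E)" "\<And>k. k \<in> txns E \<Longrightarrow> finite (pos E k)"
  obtains es where "E = FinSeq es"
proof (cases E)
  case (InfSeq f)
  have "UNIV = (\<Union>k\<in>txns E. pos E k)"
    by (auto simp: txns_def pos_def InfSeq)
  then have "finite (UNIV :: nat set)" using assms by (metis finite_UN_I)
  then show ?thesis by simp
qed (use that in blast)

lemma proj_FinSeq_finite: "proj E k = FinSeq xs \<Longrightarrow> finite (pos E k)"
  by (cases E) (auto simp: Let_def pos_def split: if_splits)

text \<open>Any event of the later participant bounds all positions of \<open>k\<close>. This
  provides finiteness for the transaction whose reads are hidden, since its own projection is not
  prescribed there.\<close>

lemma all_before_finite:
  assumes "all_before E k m" "m \<in> txns E" shows "finite (pos E k)"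
proof -
  obtain j where "j \<in> pos E m" using assms(2) by (auto simp: txns_def)
  then have "pos E k \<subseteq> {..<j}" using assms(1) by (auto simp: all_before_def)
  then show ?thesis using finite_subset by blast
qed

section \<open>Executions\<close>

lemma fin_execution_appendD: "fin_execution M (A @ B) \<Longrightarrow> fin_execution M A"
proof (induction B rule: rev_induct)
  case (snoc e B)
  have "fin_execution M ((A @ B) @ [e])" using snoc.prems by simp
  then have "fin_execution M (A @ B)" by (cases rule: fin_execution.cases) auto
  then show ?case by (rule snoc.IH)
qed simp

lemma fin_execution_enabled:
  assumes "fin_execution M (A @ e # B)" shows "enabled M A e"
proof -
  have "fin_execution M (A @ [e])" using assms fin_execution_appendD[of M "A @ [e]" B] by simp
  then show ?thesis by (cases rule: fin_execution.cases) auto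
qed

lemma execution_FinSeq: "execution M (FinSeq es) \<longleftrightarrow> fin_execution M es"
proof
  assume "execution M (FinSeq es)"
  then have "fin_execution M (prefix_of (length es) (FinSeq es))"
    unfolding execution_def by blast
  then show "fin_execution M es" by simp
next
  assume "fin_execution M es"
  then have "fin_execution M (take n es)" for n
    using fin_execution_appendD[of M "take n es" "drop n es"] by simp
  then show "execution M (FinSeq es)" by (simp add: execution_def)
qed

section \<open>Local views of processes and indistinguishable configurations\<close>

definition at_process :: "'p \<Rightarrow> ('p, 'x, 'v, 'b, 's, 'r) event list \<Rightarrow> ('p, 'x, 'v, 'b, 's, 'r) event list" where
  "at_process p E = filter (\<lambda>e. process_of (txn e) = p) E"

lemma at_process_append [simp]: "at_process p (A @ B) = at_process p A @ at_process p B"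
  by (simp add: at_process_def)

lemma at_process_other: "\<forall>e\<in>set E. process_of (txn e) \<noteq> p \<Longrightarrow> at_process p E = []"
  by (simp add: at_process_def)

lemma sublist_of_at_process: "process_of k = p \<Longrightarrow> sublist_of (at_process p E) k = sublist_of E k"
  unfolding sublist_of_def at_process_def filter_filter by (rule filter_cong) auto

text \<open>A nontrivial primitive may still fix the current value, so this expresses a possible
  change. Its negation guarantees that the value of \<open>b\<close> is kept in every state.\<close>

definition changes :: "'b \<Rightarrow> ('p, 'x, 'v, 'b, 's, 'r) event \<Rightarrow> bool" where
  "changes b e \<longleftrightarrow> on_object b e \<and> nontrivial e"

lemma update_base_unchanged: "\<not> changes b e \<Longrightarrow> update_base e mem b = mem b"
  by (cases e; cases "act e") (auto simp: changes_def on_object_def nontrivial_def trivial_prim_def)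

lemma update_base_cong: "mem b = mem' b \<Longrightarrow> update_base e mem b = update_base e mem' b"
  by (cases e; cases "act e") auto

lemma base_after_snoc: "base_after M (E @ [e]) = update_base e (base_after M E)"
  by (simp add: base_after_def)

lemma base_after_append_cong:
  "base_after M A b = base_after M B b \<Longrightarrow> base_after M (A @ F) b = base_after M (B @ F) b"
proof (induction F rule: rev_induct)
  case (snoc e F)
  then show ?case unfolding append_assoc[symmetric] base_after_snoc by (intro update_base_cong) simp
qed simp

lemma base_after_append_unchanged:
  "\<forall>e\<in>set F. \<not> changes b e \<Longrightarrow> base_after M (A @ F) b = base_after M A b"
proof (induction F rule: rev_induct)
  case (snoc e F)
  then show ?case
    unfolding append_assoc[symmetric] base_after_snoc by (simp add: update_base_unchanged)
qed simp

lemma txns_of_process: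
  "{m \<in> txns (FinSeq E). process_of m = p} = txn ` set (at_process p E)"
  by (auto simp: txns_FinSeq at_process_def)

lemma pending_cong:
  assumes "at_process (process_of k) E = at_process (process_of k) E'"
  shows "pending E k op = pending E' k op"
proof -
  have "sublist_of E k = sublist_of E' k"
    using sublist_of_at_process[OF refl, of k E] sublist_of_at_process[OF refl, of k E'] assms by simp
  then show ?thesis by (simp add: pending_def)
qed

lemma may_invoke_cong:
  assumes "at_process (process_of k) E = at_process (process_of k) E'"
  shows "may_invoke E k = may_invoke E' k"
proof -
  have sub: "sublist_of E m = sublist_of E' m" if "process_of m = process_of k" for m
    using sublist_of_at_process[OF that, of E] sublist_of_at_process[OF that, of E'] assms by simp
  have "{m \<in> txns (FinSeq E). process_of m = process_of k} =
      {m \<in> txns (FinSeq E'). process_of m = process_of k}"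
    using assms by (simp add: txns_of_process)
  then have "m \<in> txns (FinSeq E) \<longleftrightarrow> m \<in> txns (FinSeq E')" if "process_of m = process_of k" for m
    using that by blast
  then show ?thesis
    unfolding may_invoke_def using sub t_complete_cong[OF sub] pending_cong[OF assms] by blast
qed

text \<open>The local state, the pending t-operation and the permission to invoke are determined by
  the events of the own process. Shared memory enters only through the response of a primitive,
  hence only through the object accessed.\<close>

lemma enabled_cong:
  assumes "at_process (process_of (txn e)) E = at_process (process_of (txn e)) E'"
    and "\<And>b. on_object b e \<Longrightarrow> base_after M E b = base_after M E' b"
  shows "enabled M E e = enabled M E' e"
proof -
  obtain k a where e: "e = Event k a" by (cases e)
  have st: "state_after M E (process_of k) = state_after M E' (process_of k)"
    using assms(1) by (simp add: state_after_def at_process_def e)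
  have pend: "pending E k = pending E' k"
    using assms(1) pending_cong[of k E E'] by (auto simp: e)
  show ?thesis
    using assms pend may_invoke_cong[of k E E']
    by (cases a) (simp_all add: e st on_object_def)
qed

text \<open>A process cannot distinguish two configurations in which it is in the same state and which
  agree on the base objects that it accesses.\<close>

lemma fin_execution_transfer:
  assumes "fin_execution M (A @ F)" "fin_execution M B"
    and "\<forall>e\<in>set F. process_of (txn e) = p" "at_process p A = at_process p B"
    and "\<forall>e\<in>set F. \<forall>b. on_object b e \<longrightarrow> base_after M A b = base_after M B b"
  shows "fin_execution M (B @ F)"
  using assms(1,3,5)
proof (induction F rule: rev_induct)
  case Nil
  then show ?case using assms(2) by simp
next
  case (snoc e F)
  have ex: "fin_execution M ((A @ F) @ [e])" using snoc.prems(1) by simp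
  then have "fin_execution M (A @ F)" by (rule fin_execution_appendD)
  then have "fin_execution M (B @ F)"
  proof (rule snoc.IH)
    show "\<forall>e\<in>set F. process_of (txn e) = p" using snoc.prems(2) by simp
    show "\<forall>e\<in>set F. \<forall>b. on_object b e \<longrightarrow> base_after M A b = base_after M B b"
      using snoc.prems(3) by auto
  qed
  moreover have "enabled M (A @ F) e = enabled M (B @ F) e"
  proof (rule enabled_cong)
    show "at_process (process_of (txn e)) (A @ F) = at_process (process_of (txn e)) (B @ F)"
      using assms(4) snoc.prems(2) by (simp only: at_process_append) simp
    show "base_after M (A @ F) b = base_after M (B @ F) b" if "on_object b e" for b
      by (rule base_after_append_cong) (use snoc.prems(3) that in auto)
  qed
  moreover have "enabled M (A @ F) e" by (rule fin_execution_enabled[OF ex])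
  ultimately have "fin_execution M ((B @ F) @ [e])" by (simp only: fin_execution.snoc)
  then show ?case by simp
qed

lemma contend_on_iff:
  "contend_on b e e' \<longleftrightarrow> on_object b e \<and> on_object b e' \<and> (changes b e \<or> changes b e')"
  by (auto simp: contend_on_def changes_def)

section \<open>Weak disjoint-access parallelism\<close>

lemma Dset_FinSeq_mono: "set A \<subseteq> set B \<Longrightarrow> Dset (FinSeq A) k \<subseteq> Dset (FinSeq B) k"
  by (auto simp: Dset_def Rset_FinSeq Wset_FinSeq)

text \<open>Each edge arises from a single data set, which lies either inside or outside
  \<open>P\<close>. So a path starting in \<open>P\<close> never leaves it.\<close>

lemma disjoint_access_separated:
  assumes sep: "\<And>k. Dset E k \<subseteq> P \<or> Dset E k \<inter> P = {}"
    and "Dset E i \<subseteq> P" "Dset E j \<inter> P = {}"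
  shows "disjoint_access E i j"
proof -
  have "Y \<in> P" if "(X, Y) \<in> (dap_edges E i j)\<^sup>*" "X \<in> P" for X Y
    using that
  proof (induction rule: rtrancl_induct)
    case (step Y Y')
    then obtain k where "Y \<in> Dset E k" "Y' \<in> Dset E k" by (auto simp: dap_edges_def)
    then show ?case using sep[of k] step by blast
  qed
  then show ?thesis using assms(2,3) unfolding disjoint_access_def by blast
qed

text \<open>The local state fixes the next primitive whatever the memory contains. A different
  memory only alters the response, which is therefore recomputed.\<close>

lemma enabled_Rmw_transfer:
  assumes "enabled M E (Event k (Rmw b g h r))"
    and "at_process (process_of k) E = at_process (process_of k) E'"
  shows "enabled M E' (Event k (Rmw b g h (h (base_after M E' b))))"
proof -
  have "state_after M E (process_of k) = state_after M E' (process_of k)"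
    using assms(2) by (simp add: state_after_def at_process_def)
  moreover have "pending E k = pending E' k"
    using pending_cong[OF assms(2)] by auto
  ultimately show ?thesis using assms(1) by simp
qed

text \<open>If the two fragments contend, then pausing the first one just before its contending event and
  running the second one up to its first contending event makes both transactions poised to
  contend.\<close>

lemma weak_DAP_no_contention:
  fixes A F G :: "('p, 'x, 'v, 'b, 's, 'r) event list"
  assumes dap: "weak_DAP M"
    and ex: "fin_execution M (A @ F @ G)"
    and F: "\<forall>e\<in>set F. txn e = i" and G: "\<forall>e\<in>set G. txn e = j"
    and ij: "process_of i \<noteq> process_of j"
    and sep: "\<And>k. Dset (FinSeq (A @ F @ G)) k \<subseteq> P \<or> Dset (FinSeq (A @ F @ G)) k \<inter> P = {}"
      "Dset (FinSeq (A @ F @ G)) i \<subseteq> P" "Dset (FinSeq (A @ F @ G)) j \<inter> P = {}"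
    and e: "e \<in> set F" "e' \<in> set G"
  shows "\<not> contend_on b e e'"
proof
  assume "contend_on b e e'"
  then have "\<exists>e'\<in>set G. \<exists>e\<in>set F. \<exists>b. contend_on b e e'" using e by blast
  \<comment> \<open>\<open>f'\<close> is the first event of \<open>G\<close> that contends with some
    event of \<open>F\<close>; hence \<open>G1\<close> cannot tell how much of \<open>F\<close> has
    been executed.\<close>
  then obtain G1 f' G2 where Geq: "G = G1 @ f' # G2" and f': "\<exists>e\<in>set F. \<exists>b. contend_on b e f'"
    and G1: "\<forall>g\<in>set G1. \<not> (\<exists>e\<in>set F. \<exists>b. contend_on b e g)"
    using split_list_first_prop[of G "\<lambda>e'. \<exists>e\<in>set F. \<exists>b. contend_on b e e'"] by blast
  obtain f c where f: "f \<in> set F" and c: "contend_on c f f'" using f' by blast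
  obtain F1 F2 where Feq: "F = F1 @ f # F2" using f by (meson split_list)
  define E where "E = (A @ F1) @ G1"
  have exF: "fin_execution M ((A @ F) @ G1 @ f' # G2)" using ex Geq by simp
  have exFG1: "fin_execution M ((A @ F) @ G1)"
    using exF fin_execution_appendD[of M "(A @ F) @ G1" "f' # G2"] by simp
  have exF1: "fin_execution M ((A @ F1) @ f # F2 @ G)" using ex Feq by simp
  have at_j: "at_process (process_of j) F = []" "at_process (process_of j) F1 = []"
    using F ij Feq by (auto intro!: at_process_other)
  have at_i: "at_process (process_of i) G1 = []"
    using G ij Geq by (intro at_process_other) fastforce
  have "fin_execution M E" unfolding E_def
  proof (rule fin_execution_transfer[OF exFG1, where p = "process_of j"])
    show "fin_execution M (A @ F1)" using exF1 by (rule fin_execution_appendD)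
    show "\<forall>e\<in>set G1. process_of (txn e) = process_of j" using G Geq by simp
    show "at_process (process_of j) (A @ F) = at_process (process_of j) (A @ F1)"
      using at_j by simp
    show "\<forall>g\<in>set G1. \<forall>b. on_object b g \<longrightarrow> base_after M (A @ F) b = base_after M (A @ F1) b"
    proof (intro ballI allI impI)
      fix g b assume "g \<in> set G1" "on_object b g"
      \<comment> \<open>An event of \<open>f # F2\<close> changing \<open>b\<close> would contend
        with \<open>g\<close>, against the choice of \<open>G1\<close>.\<close>
      then have "\<forall>x\<in>set (f # F2). \<not> changes b x"
        using G1 Feq by (fastforce simp: contend_on_iff changes_def)
      then show "base_after M (A @ F) b = base_after M (A @ F1) b"
        using base_after_append_unchanged[of "f # F2" b M "A @ F1"] Feq by simp
    qed
  qed
  moreover have "concurrently_contend M E i j c"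
  proof -
    have "enabled M (A @ F1) f" using exF1 by (rule fin_execution_enabled)
    moreover have "enabled M (A @ F1) f = enabled M E f"
    proof (rule enabled_cong)
      show "at_process (process_of (txn f)) (A @ F1) = at_process (process_of (txn f)) E"
        using F f at_i by (simp add: E_def)
      fix b assume "on_object b f"
      then have "\<forall>g\<in>set G1. \<not> changes b g"
        using G1 f by (fastforce simp: contend_on_iff changes_def)
      then show "base_after M (A @ F1) b = base_after M E b"
        unfolding E_def by (simp only: base_after_append_unchanged)
    qed
    ultimately have pi: "poised M E i f" using F f by (simp add: poised_def)
    obtain g h r where gh: "act f' = Rmw c g h r"
      using c by (auto simp: contend_on_def on_object_def)
    \<comment> \<open>The events \<open>f # F2\<close> are missing from \<open>E\<close>, so the
      memory may differ from the one met by \<open>f'\<close>. The poised event applies the same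
      primitive with a recomputed response.\<close>
    define f'' :: "('p, 'x, 'v, 'b, 's, 'r) event"
      where "f'' = Event j (Rmw c g h (h (base_after M E c)))"
    have "f' = Event j (Rmw c g h r)" using gh G Geq by (cases f') simp
    then have "enabled M ((A @ F) @ G1) (Event j (Rmw c g h r))"
      using fin_execution_enabled[of M "(A @ F) @ G1" f' G2] exF by simp
    moreover have "at_process (process_of j) ((A @ F) @ G1) = at_process (process_of j) E"
      using at_j by (simp add: E_def)
    ultimately have pj: "poised M E j f''"
      unfolding poised_def f''_def using enabled_Rmw_transfer by (metis event.sel(1))
    have "contend_on c f f''"
      using c gh by (auto simp: contend_on_def on_object_def nontrivial_def f''_def)
    then show ?thesis using pi pj unfolding concurrently_contend_def by blast
  qed
  moreover have "i \<noteq> j" using ij by auto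
  ultimately have *: "\<not> disjoint_access (FinSeq E) i j \<or> Dset (FinSeq E) i \<inter> Dset (FinSeq E) j \<noteq> {}"
    using dap unfolding weak_DAP_def by blast
  \<comment> \<open>Data sets only shrink by truncation, so \<open>P\<close> still separates
    \<open>i\<close> from \<open>j\<close> in \<open>E\<close>, against weak DAP.\<close>
  have "set E \<subseteq> set (A @ F @ G)" by (auto simp: E_def Feq Geq)
  then have sub: "Dset (FinSeq E) k \<subseteq> Dset (FinSeq (A @ F @ G)) k" for k
    by (rule Dset_FinSeq_mono)
  have "disjoint_access (FinSeq E) i j"
  proof (rule disjoint_access_separated)
    show "Dset (FinSeq E) k \<subseteq> P \<or> Dset (FinSeq E) k \<inter> P = {}" for k
      using sep(1)[of k] sub[of k] by blast
  qed (use sep(2,3) sub[of i] sub[of j] in blast)+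
  moreover have "Dset (FinSeq E) i \<inter> Dset (FinSeq E) j = {}"
    using sep(2,3) sub[of i] sub[of j] by blast
  ultimately show False using * by blast
qed

section \<open>Solo runs of transactions\<close>

definition rmws :: "'p txn \<Rightarrow> ('p, 'x, 'v, 'b, 's, 'r) event list \<Rightarrow> bool" where
  "rmws k F \<longleftrightarrow> (\<forall>e\<in>set F. txn e = k \<and> (\<exists>b g h r. act e = Rmw b g h r))"

fun solo :: "'p txn \<Rightarrow> (('x, 'v) operation \<times> 'v response) list
    \<Rightarrow> ('p, 'x, 'v, 'b, 's, 'r) event list \<Rightarrow> bool" where
  "solo k [] G \<longleftrightarrow> G = []"
| "solo k ((op, r) # ors) G \<longleftrightarrow>
    (\<exists>F G'. rmws k F \<and> G = Event k (Inv op) # F @ Event k (Resp r) # G' \<and> solo k ors G')"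

fun solo_history :: "'p txn \<Rightarrow> (('x, 'v) operation \<times> 'v response) list
    \<Rightarrow> ('p, 'x, 'v, 'b, 's, 'r) event list" where
  "solo_history k [] = []"
| "solo_history k ((op, r) # ors) = Event k (Inv op) # Event k (Resp r) # solo_history k ors"

lemma rmws_txn: "rmws k F \<Longrightarrow> e \<in> set F \<Longrightarrow> txn e = k"
  by (auto simp: rmws_def)

lemma history_rmws: "rmws k F \<Longrightarrow> history F = []"
  by (auto simp: rmws_def history_def filter_empty_conv)

lemma history_Nil [simp]: "history [] = []"
  by (simp add: history_def)

lemma history_Cons:
  "history (e # E) = (if \<exists>b g h r. act e = Rmw b g h r then history E else e # history E)"
  by (auto simp: history_def)

lemma solo_txn: "solo k ors G \<Longrightarrow> e \<in> set G \<Longrightarrow> txn e = k"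
  by (induction k ors G rule: solo.induct) (auto dest: rmws_txn)

lemma history_solo: "solo k ors G \<Longrightarrow> history G = solo_history k ors"
  by (induction k ors G rule: solo.induct) (auto simp: history_Cons history_rmws)

lemma solo_snocI:
  "solo k ors G \<Longrightarrow> rmws k F \<Longrightarrow>
    solo k (ors @ [(op, r)]) (G @ Event k (Inv op) # F @ [Event k (Resp r)])"
proof (induction k ors G rule: solo.induct)
  case (2 k op' r' ors G)
  then obtain F' G' where
    "rmws k F'" "G = Event k (Inv op') # F' @ Event k (Resp r') # G'" "solo k ors G'"
    by auto
  then show ?case using 2 by auto
qed simp

lemma solo_last: "solo k ors G \<Longrightarrow> ors \<noteq> [] \<Longrightarrow> G \<noteq> [] \<and> last G = Event k (Resp (snd (last ors)))"
proof (induction k ors G rule: solo.induct)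
  case (2 k op' r' ors G)
  then show ?case by (cases "ors = []") auto
qed simp

lemma solo_history_last:
  assumes "H = solo_history k ors" "ors \<noteq> []"
  shows "H \<noteq> [] \<and> last H = Event k (Resp (snd (last ors)))"
  using assms
proof (induction k ors arbitrary: H rule: solo_history.induct)
  case (2 k op' r' ors)
  then show ?case by (cases "ors = []") auto
qed simp

lemma solo_Inv: "solo k ors G \<Longrightarrow> Event m (Inv op) \<in> set G \<Longrightarrow> m = k \<and> op \<in> fst ` set ors"
proof (induction k ors G rule: solo.induct)
  case (2 k op' r' ors G)
  then obtain F G' where
    G: "rmws k F" "G = Event k (Inv op') # F @ Event k (Resp r') # G'" "solo k ors G'"
    by auto
  have "Event m (Inv op) \<notin> set F"
    using G(1) by (auto simp: rmws_def)
  then consider "m = k" "op = op'" | "Event m (Inv op) \<in> set G'" using 2(3) G(2) by auto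
  then show ?case
  proof cases
    case 2
    then show ?thesis using "2.IH"[OF G(3)] by auto
  qed simp
qed simp

lemma pending_rmws: "rmws k F \<Longrightarrow> pending (A @ Event k (Inv op) # F) k op"
  using history_rmws[of k F] sublist_of_same[of F k]
  by (simp add: pending_def history_Cons rmws_def)

text \<open>While a t-operation is pending no invocation is allowed, \<open>next_step\<close> fixes
  the next step, and the memory fixes the response of a primitive.\<close>

lemma enabled_pending_unique:
  assumes "pending E k op" "enabled M E e" "enabled M E e'" "txn e = k" "txn e' = k"
  shows "e = e'"
proof -
  obtain a a' where "e = Event k a" "e' = Event k a'" using assms(4,5) by (metis event.exhaust_sel)
  then show ?thesis
    using assms(1-3) by (cases a; cases a') (auto simp: may_invoke_def)
qed

text \<open>The two runs are compared event by event. A response in one of them can only face the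
  same response in the other, so both end together.\<close>

lemma rmws_deterministic:
  assumes "fin_execution M (B @ F @ Event k (Resp r) # G)"
    and "fin_execution M (B @ F' @ Event k (Resp r') # G')"
    and "rmws k F" "rmws k F'" "pending B k op"
  shows "F = F' \<and> r = r'"
  using assms
proof (induction F arbitrary: B F')
  case Nil
  have e: "enabled M B (Event k (Resp r))" using Nil by (auto dest: fin_execution_enabled)
  show ?case
  proof (cases F')
    case Nil': Nil
    then have "enabled M B (Event k (Resp r'))" using Nil by (auto dest: fin_execution_enabled)
    from enabled_pending_unique[OF Nil(5) e this] show ?thesis using Nil' by simp
  next
    case (Cons f' F'')
    then have "enabled M B f'" using Nil by (auto dest: fin_execution_enabled)
    then have "f' = Event k (Resp r)"
      using enabled_pending_unique[OF Nil(5) e] Nil(4) Cons by (auto simp: rmws_def)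
    then show ?thesis using Nil(4) Cons by (auto simp: rmws_def)
  qed
next
  case (Cons f F)
  have e: "enabled M B f" using Cons.prems(1) by (auto dest: fin_execution_enabled)
  have f: "txn f = k" using Cons.prems(3) by (auto simp: rmws_def)
  show ?case
  proof (cases F')
    case Nil
    then have "enabled M B (Event k (Resp r'))"
      using Cons.prems(2) by (auto dest: fin_execution_enabled)
    then have "f = Event k (Resp r')"
      using enabled_pending_unique[OF Cons.prems(5) e] f by auto
    then show ?thesis using Cons.prems(3) by (auto simp: rmws_def)
  next
    case F': (Cons f' F'')
    then have "enabled M B f'" using Cons.prems(2) by (auto dest: fin_execution_enabled)
    then have ff': "f' = f"
      using enabled_pending_unique[OF Cons.prems(5) e] f Cons.prems(4) F' by (auto simp: rmws_def)
    \<comment> \<open>A primitive leaves the history untouched, so the t-operation remains pending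
      and the induction hypothesis applies.\<close>
    have "pending (B @ [f]) k op"
      using Cons.prems(3,5) f by (auto simp: pending_def rmws_def history_Cons)
    then have "F = F'' \<and> r = r'"
      using Cons.prems F' ff' by (intro Cons.IH[of "B @ [f]"]) (auto simp: rmws_def)
    then show ?thesis using F' ff' by simp
  qed
qed

text \<open>The only freedom of a transaction running alone is the choice of the t-operations that
  it invokes; primitives and responses are forced one operation at a time.\<close>

lemma solo_deterministic:
  assumes "fin_execution M (B @ G)" "fin_execution M (B @ G')"
    and "solo k ors G" "solo k ors' G'" "map fst ors = map fst ors'"
  shows "G = G' \<and> ors = ors'"
  using assms
proof (induction ors arbitrary: B G G' ors')
  case (Cons x ors)
  obtain op r where x: "x = (op, r)" by (cases x)
  obtain r' os' where ors': "ors' = (op, r') # os'" and os': "map fst ors = map fst os'"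
    using Cons.prems(5) x by auto
  obtain F H where F: "rmws k F" "G = Event k (Inv op) # F @ Event k (Resp r) # H" "solo k ors H"
    using Cons.prems(3) x by auto
  obtain F' H' where
    F': "rmws k F'" "G' = Event k (Inv op) # F' @ Event k (Resp r') # H'" "solo k os' H'"
    using Cons.prems(4) ors' by auto
  have "pending (B @ [Event k (Inv op)]) k op"
    using pending_rmws[of k "[]" B op] by (simp add: rmws_def)
  then have eq: "F = F'" "r = r'"
    using rmws_deterministic[of M "B @ [Event k (Inv op)]" F k r H F' r' H' op] F F' Cons.prems(1,2)
    by auto
  have "H = H' \<and> ors = os'"
    using Cons.prems(1,2) F F' eq os'
    by (intro Cons.IH[of "B @ Event k (Inv op) # F @ [Event k (Resp r)]"]) auto
  then show ?case using F F' eq ors' x by simp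
qed simp

text \<open>The events of \<open>k\<close> are contiguous at the end of the execution, so obstruction-freedom rules out
  an abort.\<close>

lemma solo_extend:
  assumes M: "M \<in> OF_class" and ex: "fin_execution M (A @ B)" and B: "solo k ors B"
    and A: "k \<notin> txn ` set A"
      "\<forall>m\<in>txn ` set A. process_of m = process_of k \<longrightarrow> t_complete (FinSeq A) m"
    and ors: "\<And>op r. (op, r) \<in> set ors \<Longrightarrow> r \<noteq> Commit \<and> r \<noteq> Abort"
  obtains F r where "fin_execution M (A @ B @ Event k (Inv op) # F @ [Event k (Resp r)])"
    "rmws k F" "matches op r" "r \<noteq> Abort"
proof -
  have subA: "sublist_of A k = []" using A(1) by (simp add: sublist_of_eq_Nil_iff)
  have subB: "sublist_of B k = B" using solo_txn[OF B] by (simp add: sublist_of_same)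
  have "may_invoke (A @ B) k"
    unfolding may_invoke_def
  proof (intro conjI ballI impI)
    show "\<nexists>op. pending (A @ B) k op"
      using solo_history_last[OF history_solo[OF B]] history_solo[OF B] subA subB
      by (cases "ors = []") (auto simp: pending_def)
    show "\<not> t_complete (FinSeq (A @ B)) k"
    proof (cases "ors = []")
      case True
      then show ?thesis using B subA by (simp add: t_complete_FinSeq)
    next
      case False
      obtain op r where l: "last ors = (op, r)" by (cases "last ors")
      then have "(op, r) \<in> set ors" using False last_in_set by metis
      then show ?thesis using solo_last[OF B False] subA subB ors[of op r] l
        by (simp add: t_complete_FinSeq)
    qed
    fix m assume m: "m \<in> txns (FinSeq (A @ B))" "m \<noteq> k \<and> process_of m = process_of k"
    then have "m \<in> txn ` set A" using solo_txn[OF B] by (auto simp: txns_FinSeq)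
    moreover have "sublist_of (A @ B) m = sublist_of A m"
      using solo_txn[OF B] m(2) by (auto intro: sublist_of_other)
    ultimately show "t_complete (FinSeq (A @ B)) m"
      using A(2) m(2) t_complete_cong by metis
  qed
  then have "fin_execution M ((A @ B) @ [Event k (Inv op)])"
    using ex by (intro fin_execution.snoc) simp_all
  then obtain F r where F: "fin_execution M ((A @ B) @ [Event k (Inv op)] @ F @ [Event k (Resp r)])"
    and r: "matches op r" and F2: "\<forall>e\<in>set F. txn e = k \<and> (\<exists>b g h r'. act e = Rmw b g h r')"
    using M unfolding OF_class_def OF_liveness_def by blast
  define C where "C = B @ Event k (Inv op) # F @ [Event k (Resp r)]"
  have "\<forall>e\<in>set C. txn e = k" using solo_txn[OF B] F2 by (auto simp: C_def)
  then have "step_contention_free (FinSeq (A @ C @ [])) k"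
    using A(1) by (intro step_contention_free_block) auto
  moreover have "execution M (FinSeq (A @ C))" using F by (simp add: execution_FinSeq C_def)
  moreover have "Event k (Resp Abort) \<in> set (A @ C) \<Longrightarrow>
      \<exists>i\<in>pos (FinSeq (A @ C)) k. act (at (FinSeq (A @ C)) i) = Resp Abort"
    unfolding pos_act_iff[symmetric] by simp
  moreover have "OF_progress M" using M by (simp add: OF_class_def)
  ultimately have "Event k (Resp Abort) \<notin> set (A @ C)"
    unfolding OF_progress_def append_Nil2 by blast
  then have "r \<noteq> Abort" by (auto simp: C_def)
  then show ?thesis using that[of F r] F r F2 by (simp add: rmws_def)
qed

text \<open>Operations are appended one by one with \<open>solo_extend\<close>. \<open>TryC\<close>
  may occur only at the end: a matching response other than \<open>Abort\<close> to a read or write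
  leaves the transaction able to continue.\<close>

lemma solo_exists:
  assumes M: "M \<in> OF_class" and ex: "fin_execution M A"
    and A: "k \<notin> txn ` set A"
      "\<forall>m\<in>txn ` set A. process_of m = process_of k \<longrightarrow> t_complete (FinSeq A) m"
    and ops: "TryC \<notin> set (butlast ops)"
  shows "\<exists>ors G. map fst ors = ops \<and> solo k ors G \<and> fin_execution M (A @ G) \<and>
    (\<forall>(op, r)\<in>set ors. matches op r \<and> r \<noteq> Abort)"
  using ops
proof (induction ops rule: rev_induct)
  case Nil
  then show ?case using ex by auto
next
  case (snoc op ops)
  then have nc: "TryC \<notin> set ops" by simp
  then have "TryC \<notin> set (butlast ops)" by (meson in_set_butlastD)
  then obtain ors G where G: "map fst ors = ops" "solo k ors G" "fin_execution M (A @ G)"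
    and r: "\<forall>(op, r)\<in>set ors. matches op r \<and> r \<noteq> Abort"
    using snoc.IH by blast
  have "r' \<noteq> Commit \<and> r' \<noteq> Abort" if "(op', r') \<in> set ors" for op' r'
  proof -
    have "op' \<noteq> TryC" using that nc G(1) by force
    then show ?thesis using r that by (cases op') auto
  qed
  then obtain F r' where F: "fin_execution M (A @ G @ Event k (Inv op) # F @ [Event k (Resp r')])"
    "rmws k F" "matches op r'" "r' \<noteq> Abort"
    using solo_extend[OF M G(3,2) A] by blast
  have "solo k (ors @ [(op, r')]) (G @ Event k (Inv op) # F @ [Event k (Resp r')])"
    using solo_snocI G(2) F(2) by blast
  then show ?case
    using F G(1) r by (intro exI[of _ "ors @ [(op, r')]"]
      exI[of _ "G @ Event k (Inv op) # F @ [Event k (Resp r')]"]) auto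
qed

section \<open>Strict serializability\<close>

text \<open>Completing events go behind the last event of their transaction, so a projection can
  only grow at its end. They are responses or invocations of \<open>TryC\<close>, and there are none
  for a t-complete transaction.\<close>

lemma completion_step_sublist:
  assumes "completion_step H H'"
  shows "\<exists>cs. sublist_of H' m = sublist_of H m @ cs \<and> (\<forall>e\<in>set cs. \<forall>X v. act e \<noteq> Inv (Write X v)) \<and>
    (t_complete (FinSeq H) m \<longrightarrow> cs = [])"
proof -
  obtain k as bs cs where H: "H = as @ bs" "\<forall>e\<in>set bs. txn e \<noteq> k"
    "cs \<in> completing_events H k" "H' = as @ cs @ bs"
    using assms unfolding completion_step_def by blast
  have cs: "\<forall>e\<in>set cs. txn e = k \<and> (\<forall>X v. act e \<noteq> Inv (Write X v))"
    and incomplete: "\<not> t_complete (FinSeq H) k"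
    using H(3) unfolding completing_events_def
    by (auto simp: t_complete_FinSeq split: if_splits action.splits operation.splits)
  show ?thesis
  proof (cases "m = k")
    case True
    have "sublist_of bs k = []" "sublist_of cs k = cs"
      using H(2) cs by (auto intro: sublist_of_other sublist_of_same)
    then show ?thesis using H cs incomplete True by auto
  next
    case False
    then have "sublist_of cs m = []" using cs by (auto intro: sublist_of_other)
    then show ?thesis using H by auto
  qed
qed

lemma completion_sublist:
  assumes "completion_step\<^sup>*\<^sup>* H H'"
  shows "\<exists>cs. sublist_of H' m = sublist_of H m @ cs \<and> (\<forall>e\<in>set cs. \<forall>X v. act e \<noteq> Inv (Write X v)) \<and>
    (t_complete (FinSeq H) m \<longrightarrow> cs = [])"
  using assms
proof (induction rule: rtranclp_induct)
  case (step H' H'')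
  then obtain cs where cs: "sublist_of H' m = sublist_of H m @ cs"
    "\<forall>e\<in>set cs. \<forall>X v. act e \<noteq> Inv (Write X v)" "t_complete (FinSeq H) m \<longrightarrow> cs = []" by blast
  obtain cs' where cs': "sublist_of H'' m = sublist_of H' m @ cs'"
    "\<forall>e\<in>set cs'. \<forall>X v. act e \<noteq> Inv (Write X v)" "t_complete (FinSeq H') m \<longrightarrow> cs' = []"
    using completion_step_sublist[OF step.hyps(2)] by blast
  have "t_complete (FinSeq H) m \<longrightarrow> t_complete (FinSeq H') m"
    using cs t_complete_cong[of H' m H] by simp
  then show ?case using cs cs' by (intro exI[of _ "cs @ cs'"]) auto
qed simp

lemma rt_prec_trans: "rt_prec E k m \<Longrightarrow> rt_prec E m l \<Longrightarrow> rt_prec E k l"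
  unfolding rt_prec_def all_before_def txns_def by (blast intro: less_trans)

lemma written_value_eq_Some: "written_value X a = Some v \<longleftrightarrow> a = Inv (Write X v)"
  by (induction X a rule: written_value.induct) auto

lemma writes_to_Nil [simp]: "writes_to X [] = []"
  by (simp add: writes_to_def map_filter_simps)

lemma set_writes_to: "set (writes_to X es) = {v. \<exists>e\<in>set es. act e = Inv (Write X v)}"
  unfolding writes_to_def written_value_eq_Some[symmetric]
  by (induction es) (auto simp: map_filter_simps split: option.splits)

lemma filter_eq_Cons_Cons:
  assumes "filter P xs = a # b # ys"
  obtains us vs ws where "xs = us @ a # vs @ b # ws" "\<forall>u\<in>set us. \<not> P u" "\<forall>v\<in>set vs. \<not> P v"
proof -
  obtain us ws' where 1: "xs = us @ a # ws'" "\<forall>u\<in>set us. \<not> P u" "filter P ws' = b # ys"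
    using assms by (auto simp: filter_eq_Cons_iff[of P xs])
  then obtain vs ws where "ws' = vs @ b # ws" "\<forall>v\<in>set vs. \<not> P v"
    by (auto simp: filter_eq_Cons_iff)
  then show ?thesis using 1 that by blast
qed

text \<open>A read that opens its transaction has no own write before it, which leaves the committed
  predecessors and the initial value.\<close>

lemma legal_first_read:
  assumes legal: "legal init S"
    and S: "sublist_of S k = Event k (Inv (Read X)) # Event k (Resp (Val v)) # rest"
    and prev: "prev = writes_to X (filter (\<lambda>e. committed (FinSeq S) (txn e) \<and> rt_prec (FinSeq S) (txn e) k) S)"
  shows "v = (if prev \<noteq> [] then last prev else init X)"
proof -
  obtain us vs ws where us: "S = us @ Event k (Inv (Read X)) # vs @ Event k (Resp (Val v)) # ws"
    "\<forall>u\<in>set us. txn u \<noteq> k" "\<forall>u\<in>set vs. txn u \<noteq> k"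
    using S unfolding sublist_of_def by (rule filter_eq_Cons_Cons)
  define i where "i = length us"
  define j where "j = Suc (length us + length vs)"
  have nth: "S ! i = Event k (Inv (Read X))" "S ! j = Event k (Resp (Val v))"
    by (simp_all add: us(1) i_def j_def nth_append)
  have "txn (S ! l) \<noteq> k" if "i < l" "l < j" for l
  proof -
    \<comment> \<open>Position \<open>i\<close> holds the invocation itself, hence the offset by one
      when \<open>l\<close> is located inside \<open>vs\<close>.\<close>
    define d where "d = l - Suc i"
    have d: "l = length us + Suc d" "d < length vs" using that by (auto simp: i_def j_def d_def)
    then have "S ! l = vs ! d" by (simp only: us(1) nth_append_length_plus) (simp add: nth_append)
    then show ?thesis using us(3) d(2) by simp
  qed
  moreover have "i < j" "j < length S" by (simp_all add: us(1) i_def j_def)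
  ultimately have "v = latest_written init S i k X"
    using legal nth unfolding legal_def by blast
  moreover have "sublist_of (take i S) k = []"
    using us(2) by (simp add: us(1) i_def sublist_of_other)
  ultimately show ?thesis
    by (simp add: latest_written_def prev[symmetric] Let_def)
qed

text \<open>What the argument needs from a serialization, expressed on \<open>H\<close> alone.
  \<open>C\<close> stands for the transactions committed in the completion, possibly including one
  whose \<open>TryC\<close> is still pending in \<open>H\<close>, and \<open>prec\<close> for their
  serial order. \<open>first_read\<close> forgets which preceding write is the latest, as the
  histories considered have very few writes.\<close>

locale serial_order =
  fixes init :: "'x \<Rightarrow> 'v" and H :: "('p, 'x, 'v, 'b, 's, 'r) event list"
    and C :: "'p txn set" and prec :: "'p txn \<Rightarrow> 'p txn \<Rightarrow> bool"
  assumes committed_in: "committed (FinSeq H) k \<Longrightarrow> k \<in> C"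
    and total: "k \<in> C \<Longrightarrow> m \<in> C \<Longrightarrow> k \<noteq> m \<Longrightarrow> prec k m \<or> prec m k"
    and trans: "prec k m \<Longrightarrow> prec m l \<Longrightarrow> prec k l"
    and real_time: "k \<in> C \<Longrightarrow> m \<in> C \<Longrightarrow> rt_prec (FinSeq H) k m \<Longrightarrow> prec k m"
    and first_read: "k \<in> C \<Longrightarrow>
      sublist_of H k = Event k (Inv (Read X)) # Event k (Resp (Val v)) # rest \<Longrightarrow>
      (\<exists>m\<in>C. prec m k \<and> Event m (Inv (Write X v)) \<in> set H) \<or>
      v = init X \<and> \<not> (\<exists>m\<in>C. \<exists>w. prec m k \<and> Event m (Inv (Write X w)) \<in> set H)"

lemma serialization:
  assumes "strictly_serializable_history init H"
  obtains C prec where "serial_order init H C prec"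
proof -
  obtain S H' where legal: "legal init S" and seq: "t_sequential (FinSeq S)"
    and rt: "\<forall>k\<in>txns (FinSeq S). \<forall>m\<in>txns (FinSeq S).
          rt_prec (FinSeq H) k m \<longrightarrow> rt_prec (FinSeq S) k m"
    and completes: "completion_step\<^sup>*\<^sup>* H H'"
    and eqv: "equivalent S (filter (\<lambda>e. committed (FinSeq H') (txn e)) H')"
    using assms unfolding strictly_serializable_history_def completion_def by blast
  define D where "D = filter (\<lambda>e. committed (FinSeq H') (txn e)) H'"
  define C where "C = txns (FinSeq S)"
  have subD: "sublist_of D k = (if committed (FinSeq H') k then sublist_of H' k else [])" for k
    by (auto simp: D_def sublist_of_def filter_empty_conv intro!: filter_cong)
  have inC: "k \<in> C \<longleftrightarrow> committed (FinSeq H') k" for k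
  proof -
    have "k \<in> C \<longleftrightarrow> sublist_of D k \<noteq> []"
      using eqv unfolding C_def equivalent_def D_def[symmetric]
      by (simp add: txns_FinSeq sublist_of_eq_Nil_iff)
    then show ?thesis by (auto simp: subD committed_FinSeq)
  qed
  have subS: "sublist_of S k = sublist_of H' k" if "k \<in> C" for k
    using eqv that inC[of k] subD[of k] unfolding equivalent_def D_def[symmetric] C_def by simp
  have commS: "committed (FinSeq S) k" if "k \<in> C" for k
    using that subS inC by (simp add: committed_FinSeq)
  \<comment> \<open>A completion adds no write invocations, so values read in \<open>S\<close> can
    be traced back to writes in \<open>H\<close>.\<close>
  have same_writes: "Event k (Inv (Write X w)) \<in> set S \<longleftrightarrow> Event k (Inv (Write X w)) \<in> set H"
    if k: "k \<in> C" for k X w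
  proof -
    obtain cs where cs: "sublist_of S k = sublist_of H k @ cs"
      "\<forall>e\<in>set cs. \<forall>X v. act e \<noteq> Inv (Write X v)"
      using completion_sublist[OF completes, of k] subS[OF k] by auto
    have "Event k (Inv (Write X w)) \<notin> set cs" using cs(2) by force
    moreover have "Event k (Inv (Write X w)) \<in> set S \<longleftrightarrow> Event k (Inv (Write X w)) \<in> set (sublist_of S k)"
      by simp
    ultimately show ?thesis by (simp add: cs(1) del: set_sublist_of) simp
  qed
  show ?thesis
  proof (rule that[of C "rt_prec (FinSeq S)"], unfold_locales)
    show "k \<in> C" if k: "committed (FinSeq H) k" for k
    proof -
      have "t_complete (FinSeq H) k" using k by (simp add: t_complete_def)
      then have "sublist_of H' k = sublist_of H k" using completion_sublist[OF completes, of k] by auto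
      then show ?thesis using k by (simp add: inC committed_FinSeq)
    qed
    show "rt_prec (FinSeq S) k m \<or> rt_prec (FinSeq S) m k" if "k \<in> C" "m \<in> C" "k \<noteq> m" for k m
      using that seq unfolding t_sequential_def concurrent_def C_def by blast
    show "rt_prec (FinSeq S) k m" if "k \<in> C" "m \<in> C" "rt_prec (FinSeq H) k m" for k m
      using that rt unfolding C_def by blast
    fix k X v rest
    assume k: "k \<in> C" and "sublist_of H k = Event k (Inv (Read X)) # Event k (Resp (Val v)) # rest"
    then obtain rest' where "sublist_of S k = Event k (Inv (Read X)) # Event k (Resp (Val v)) # rest'"
      using completion_sublist[OF completes, of k] subS[OF k] by auto
    note read = legal_first_read[OF legal this refl]
    define prev where "prev = writes_to X (filter (\<lambda>e. committed (FinSeq S) (txn e) \<and> rt_prec (FinSeq S) (txn e) k) S)"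
    have prev: "w \<in> set prev \<longleftrightarrow> (\<exists>m\<in>C. rt_prec (FinSeq S) m k \<and> Event m (Inv (Write X w)) \<in> set H)" for w
    proof
      assume "w \<in> set prev"
      then obtain e where e: "e \<in> set S" "rt_prec (FinSeq S) (txn e) k" "act e = Inv (Write X w)"
        by (auto simp: prev_def set_writes_to)
      then have "e = Event (txn e) (Inv (Write X w))" by (metis event.collapse)
      moreover have "txn e \<in> C" using e(1) by (simp add: C_def txns_FinSeq)
      ultimately show "\<exists>m\<in>C. rt_prec (FinSeq S) m k \<and> Event m (Inv (Write X w)) \<in> set H"
        using e(1,2) same_writes by metis
    next
      assume "\<exists>m\<in>C. rt_prec (FinSeq S) m k \<and> Event m (Inv (Write X w)) \<in> set H"
      then show "w \<in> set prev" using same_writes commS by (force simp: prev_def set_writes_to)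
    qed
    show "(\<exists>m\<in>C. rt_prec (FinSeq S) m k \<and> Event m (Inv (Write X v)) \<in> set H) \<or>
      v = init X \<and> \<not> (\<exists>m\<in>C. \<exists>w. rt_prec (FinSeq S) m k \<and> Event m (Inv (Write X w)) \<in> set H)"
    proof (cases "prev = []")
      case True
      then show ?thesis using read prev unfolding prev_def[symmetric] by auto
    next
      case False
      then have "v \<in> set prev" using read unfolding prev_def[symmetric] by simp
      then show ?thesis using prev by blast
    qed
  qed (rule rt_prec_trans)
qed

section \<open>Invisible reads\<close>

lemma Dset_append: "Dset (FinSeq (A @ B)) k = Dset (FinSeq A) k \<union> Dset (FinSeq B) k"
  by (auto simp: Dset_def Rset_FinSeq Wset_FinSeq)

lemma Dset_other: "\<forall>e\<in>set E. txn e \<noteq> k \<Longrightarrow> Dset (FinSeq E) k = {}"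
  by (force simp: Dset_def Rset_FinSeq Wset_FinSeq)

lemma read_only_trivial:
  assumes "invisible_reads M" "fin_execution M E" "Wset (FinSeq E) k = {}" "e \<in> set E" "txn e = k"
  shows "\<not> nontrivial e"
proof -
  obtain i where i: "i < length E" "E ! i = e" using assms(4) by (auto simp: in_set_conv_nth)
  have "k \<in> txns (FinSeq E)" using assms(4,5) by (auto simp: txns_FinSeq)
  moreover have "i \<in> pos (FinSeq E) k" using i assms(5) by (simp add: pos_FinSeq)
  moreover have "execution M (FinSeq E)" using assms(2) by (simp add: execution_FinSeq)
  moreover have "read_only (FinSeq E) k" using assms(3) by (simp add: read_only_def)
  ultimately have "\<not> nontrivial (at (FinSeq E) i)"
    using assms(1) unfolding invisible_reads_def by blast
  then show ?thesis using i by simp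
qed

text \<open>The events of \<open>k\<close> form a prefix, and so do those of \<open>k\<close> and
  \<open>i\<close> together. Splitting at both places leaves exactly the three blocks.\<close>

lemma all_before_blocks:
  assumes txns: "txn ` set es \<subseteq> {k, i, j}" and "k \<noteq> i" "k \<noteq> j" "i \<noteq> j"
    and before: "all_before (FinSeq es) k i" "all_before (FinSeq es) k j" "all_before (FinSeq es) i j"
  shows "es = sublist_of es k @ sublist_of es i @ sublist_of es j"
proof -
  have less: "a < b" if "all_before (FinSeq es) m l" "a < length es" "b < length es"
    "txn (es ! a) = m" "txn (es ! b) = l" for a b m l
    using that by (simp add: all_before_def pos_FinSeq)
  have in3: "txn (es ! a) \<in> {k, i, j}" if "a < length es" for a
    using txns that nth_mem by blast
  have 1: "es = filter (\<lambda>e. txn e = k) es @ filter (\<lambda>e. txn e \<noteq> k) es"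
  proof (rule split_by_order)
    fix a b assume ab: "a < b" "b < length es" "txn (es ! b) = k"
    then show "txn (es ! a) = k"
      using in3[of a] less[OF before(1), of b a] less[OF before(2), of b a] by auto
  qed
  have 2: "es = filter (\<lambda>e. txn e = k \<or> txn e = i) es @ filter (\<lambda>e. \<not> (txn e = k \<or> txn e = i)) es"
  proof (rule split_by_order)
    fix a b assume ab: "a < b" "b < length es" "txn (es ! b) = k \<or> txn (es ! b) = i"
    then show "txn (es ! a) = k \<or> txn (es ! a) = i"
      using in3[of a] less[OF before(3), of b a] less[OF before(2), of b a] by auto
  qed
  have "filter (\<lambda>e. txn e = k \<or> txn e = i) es =
      filter (\<lambda>e. txn e = k \<or> txn e = i) (filter (\<lambda>e. txn e = k) es @ filter (\<lambda>e. txn e \<noteq> k) es)"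
    using 1 by simp
  also have "\<dots> = sublist_of es k @ sublist_of es i"
    using assms(2) by (auto simp: sublist_of_def intro!: arg_cong2[of _ _ _ _ "(@)"] filter_cong)
  finally have "filter (\<lambda>e. txn e = k \<or> txn e = i) es = sublist_of es k @ sublist_of es i" .
  moreover have "filter (\<lambda>e. \<not> (txn e = k \<or> txn e = i)) es = sublist_of es j"
    using txns assms(3,4) unfolding sublist_of_def by (intro filter_cong) auto
  ultimately show ?thesis using 2 by simp
qed

text \<open>The transaction \<open>k\<close> executes first, without any step contention, so the execution in which its
  reads are hidden has the same blocks.\<close>

lemma hide_reads:
  assumes inv: "invisible_reads M" and ex: "fin_execution M (A @ B @ C)"
    and A: "\<forall>e\<in>set A. txn e = k" and B: "\<forall>e\<in>set B. txn e = i" and C: "\<forall>e\<in>set C. txn e = j"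
    and dist: "k \<noteq> i" "k \<noteq> j" "i \<noteq> j" and "B \<noteq> []"
    and upd: "Wset (FinSeq A) k \<noteq> {}" "Rset (FinSeq A) k \<noteq> {}"
  obtains A' where "fin_execution M (A' @ B @ C)" "\<forall>e\<in>set A'. txn e = k"
    "Dset (FinSeq A') k \<subseteq> Wset (FinSeq A) k"
proof -
  define E where "E = FinSeq (A @ B @ C)"
  have sub: "sublist_of (A @ B @ C) k = A" "sublist_of (A @ B @ C) i = B" "sublist_of (A @ B @ C) j = C"
    using A B C dist by (simp_all add: sublist_of_same sublist_of_other)
  have "A \<noteq> []" using upd by (auto simp: Wset_FinSeq)
  have txnsE: "txns E \<subseteq> {k, i, j}" "k \<in> txns E" "i \<in> txns E"
    using A B C \<open>A \<noteq> []\<close> \<open>B \<noteq> []\<close> by (cases A; cases B; auto simp: E_def txns_FinSeq)+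
  have Wset: "Wset E k = Wset (FinSeq A) k"
    using B C dist by (auto simp: E_def Wset_FinSeq)
  have "Rset E k \<noteq> {}" using upd(2) by (auto simp: E_def Rset_FinSeq)
  moreover have "execution M E" using ex by (simp add: E_def execution_FinSeq)
  moreover have "updating E k" using upd(1) Wset by (simp add: updating_def)
  ultimately obtain E' where E': "execution M E'" "Rset E' k = {}" "Wset E' k \<subseteq> Wset E k"
    "txns E = txns E'" and proj: "\<forall>m\<in>txns E - {k}. proj E m = proj E' m"
    and order: "\<forall>i\<in>txns E. \<forall>j\<in>txns E.
      step_contention_free E i \<and> step_contention_free E j \<and> all_before E i j \<longrightarrow> all_before E' i j"
    using inv txnsE(2) unfolding invisible_reads_def by blast
  have "step_contention_free (FinSeq ([] @ A @ (B @ C))) k"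
    using A B C dist by (intro step_contention_free_block) auto
  moreover have "step_contention_free (FinSeq (A @ B @ C)) i"
    using A B C dist by (intro step_contention_free_block) auto
  moreover have "step_contention_free (FinSeq ((A @ B) @ C @ [])) j"
    using A B C dist by (intro step_contention_free_block) auto
  ultimately have scf: "step_contention_free E k" "step_contention_free E i" "step_contention_free E j"
    by (simp_all add: E_def)
  have "all_before (FinSeq (A @ (B @ C))) k i" "all_before (FinSeq (A @ (B @ C))) k j"
    "all_before (FinSeq ((A @ B) @ C)) i j"
    using A B C dist by (auto intro!: all_before_append simp del: append_assoc)
  then have beforeE: "all_before E k i" "all_before E k j" "all_before E i j"
    by (simp_all add: E_def)
  \<comment> \<open>Invisible reads preserve the order of participants only. \<open>C\<close> may be
    empty; then \<open>j\<close> does not participate and the order involving it is vacuous.\<close>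
  have before: "all_before E' m l" if "all_before E m l" "step_contention_free E m" "step_contention_free E l"
    for m l
  proof (cases "m \<in> txns E \<and> l \<in> txns E")
    case True
    then show ?thesis using order that by blast
  next
    case False
    then have "m \<notin> txns E' \<or> l \<notin> txns E'" using E'(4) by simp
    then show ?thesis by (auto simp: all_before_def txns_def)
  qed
  \<comment> \<open>A priori \<open>E'\<close> might be infinite. The positions of \<open>k\<close>
    are bounded by an event of \<open>i\<close>, which participates because \<open>B\<close> is
    nonempty; the other projections agree with those of a finite execution.\<close>
  have fin: "finite (pos E' m)" if m: "m \<in> txns E'" for m
  proof (cases "m = k")
    case True
    have "i \<in> txns E'" using txnsE(3) E'(4) by simp
    then show ?thesis using True before[OF beforeE(1) scf(1,2)] all_before_finite by blast
  next
    case False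
    then have "proj E' m = FinSeq (sublist_of (A @ B @ C) m)" using proj m E'(4) by (auto simp: E_def)
    then show ?thesis by (rule proj_FinSeq_finite)
  qed
  moreover have "finite (txns E')" using txnsE(1) E'(4) finite_subset by auto
  ultimately obtain es where es: "E' = FinSeq es" using finite_projections_FinSeq by blast
  have sub': "sublist_of es m = sublist_of (A @ B @ C) m" if "m \<noteq> k" for m
  proof (cases "m \<in> txns E")
    case True
    then show ?thesis using proj that es by (auto simp: E_def)
  next
    case False
    then have "m \<notin> txn ` set es" "m \<notin> txn ` set (A @ B @ C)"
      using E'(4) es by (simp_all add: E_def txns_FinSeq)
    then show ?thesis by (metis sublist_of_eq_Nil_iff)
  qed
  have "es = sublist_of es k @ sublist_of es i @ sublist_of es j"
  proof (rule all_before_blocks)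
    show "txn ` set es \<subseteq> {k, i, j}" using txnsE(1) E'(4) es by (simp add: txns_FinSeq)
  qed (use dist before beforeE scf es in auto)
  then have es2: "es = sublist_of es k @ B @ C" using sub' sub dist by metis
  show ?thesis
  proof (rule that)
    show "fin_execution M (sublist_of es k @ B @ C)"
      using E'(1) es es2 by (simp add: execution_FinSeq)
    show "\<forall>e\<in>set (sublist_of es k). txn e = k" by simp
    have "Dset (FinSeq (sublist_of es k)) k \<subseteq> Dset (FinSeq es) k"
      by (rule Dset_FinSeq_mono) auto
    then show "Dset (FinSeq (sublist_of es k)) k \<subseteq> Wset (FinSeq A) k"
      using E'(2,3) es Wset by (auto simp: Dset_def)
  qed
qed

text \<open>If \<open>k\<close> is read-only in \<open>A\<close>, its events are trivial. Otherwise
  hiding its reads makes it disjoint-access from \<open>i\<close>, and weak DAP prevents it from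
  changing an object accessed by \<open>G\<close>. Either way \<open>i\<close> cannot notice that
  \<open>k\<close> is removed.\<close>

lemma run_from_initial_configuration:
  assumes dap: "weak_DAP M" and inv: "invisible_reads M" and ex: "fin_execution M (A @ G)"
    and A: "\<forall>e\<in>set A. txn e = k" and G: "\<forall>e\<in>set G. txn e = i"
    and ki: "process_of k \<noteq> process_of i"
    and Rset: "A \<noteq> [] \<Longrightarrow> Rset (FinSeq A) k \<noteq> {}"
    and disj: "Dset (FinSeq G) i \<inter> Wset (FinSeq A) k = {}"
  shows "fin_execution M G"
proof (cases "G = []")
  case True
  then show ?thesis by (simp add: fin_execution.empty)
next
  case nonempty: False
  \<comment> \<open>Replacing \<open>A\<close> by \<open>A'\<close> is harmless because the events
    of \<open>G\<close> are kept together with their responses.\<close>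
  have "\<exists>A'. fin_execution M (A' @ G) \<and> (\<forall>e\<in>set A'. txn e = k) \<and>
    (\<forall>e\<in>set A'. \<forall>g\<in>set G. \<forall>b. on_object b g \<longrightarrow> \<not> changes b e)"
  proof (cases "Wset (FinSeq A) k = {}")
    case True
    have "fin_execution M A" using ex by (rule fin_execution_appendD)
    then have "\<forall>e\<in>set A. \<not> nontrivial e" using read_only_trivial[OF inv _ True] A by blast
    then show ?thesis using ex A by (auto simp: changes_def)
  next
    case False
    then have "A \<noteq> []" by (auto simp: Wset_FinSeq)
    then have Rset': "Rset (FinSeq A) k \<noteq> {}" by (rule Rset)
    have ki': "k \<noteq> i" using ki by auto
    \<comment> \<open>A dummy identifier for the third block of \<open>hide_reads\<close>, which is
      empty here.\<close>
    obtain j where j: "k \<noteq> j" "i \<noteq> j"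
      using ki prod.sel n_not_Suc_n by metis
    obtain A' where A': "fin_execution M (A' @ G @ [])" "\<forall>e\<in>set A'. txn e = k"
      "Dset (FinSeq A') k \<subseteq> Wset (FinSeq A) k"
      using hide_reads[OF inv, of A G "[]" k i j] ex A G ki' j nonempty False Rset' by auto
    have Dk: "Dset (FinSeq G) m = {}" if "m \<noteq> i" for m using G that by (auto intro!: Dset_other)
    have Di: "Dset (FinSeq A') m = {}" if "m \<noteq> k" for m using A'(2) that by (auto intro!: Dset_other)
    have nc: "\<not> contend_on b e g" if "e \<in> set A'" "g \<in> set G" for e g b
    proof (rule weak_DAP_no_contention[OF dap, of "[]" A' G k i "Wset (FinSeq A) k"])
      show "Dset (FinSeq ([] @ A' @ G)) m \<subseteq> Wset (FinSeq A) k \<or>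
          Dset (FinSeq ([] @ A' @ G)) m \<inter> Wset (FinSeq A) k = {}" for m
        using A'(3) disj ki' Dk[of m] Di[of m] by (cases "m = k"; cases "m = i") (auto simp: Dset_append)
    qed (use A' G ki ki' disj Dk[of k] Di[of i] that in \<open>auto simp: Dset_append\<close>)
    have "\<not> changes b e" if "e \<in> set A'" "g \<in> set G" "on_object b g" for e g b
      using nc[OF that(1,2)] that(3) by (auto simp: contend_on_iff changes_def)
    then show ?thesis using A' by auto
  qed
  then obtain A' where A': "fin_execution M (A' @ G)" "\<forall>e\<in>set A'. txn e = k"
    and nc: "\<forall>e\<in>set A'. \<forall>g\<in>set G. \<forall>b. on_object b g \<longrightarrow> \<not> changes b e" by blast
  have "fin_execution M ([] @ G)"
  proof (rule fin_execution_transfer[OF A'(1), where p = "process_of i"])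
    show "at_process (process_of i) A' = at_process (process_of i) []"
      using A'(2) ki at_process_other[of A' "process_of i"] by (simp add: at_process_def)
    show "\<forall>g\<in>set G. \<forall>b. on_object b g \<longrightarrow> base_after M A' b = base_after M [] b"
      using nc base_after_append_unchanged[of A' _ M "[]"] by simp
  qed (use G in \<open>auto intro: fin_execution.empty\<close>)
  then show ?thesis by simp
qed

text \<open>With its reads in place, \<open>k\<close> could connect the data sets of
  \<open>i\<close> and \<open>j\<close> by reading from one and writing to the other. Hiding the
  reads cuts this connection, and the data set of \<open>i\<close> serves as the separating
  set.\<close>

lemma no_contention_behind_updater:
  assumes dap: "weak_DAP M" and inv: "invisible_reads M" and ex: "fin_execution M (A @ F @ G)"
    and A: "\<forall>e\<in>set A. txn e = k" and F: "\<forall>e\<in>set F. txn e = i" and G: "\<forall>e\<in>set G. txn e = j"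
    and dist: "process_of i \<noteq> process_of j" "k \<noteq> i" "k \<noteq> j"
    and upd: "Wset (FinSeq A) k \<noteq> {}" "Rset (FinSeq A) k \<noteq> {}"
    and disj: "Wset (FinSeq A) k \<inter> Dset (FinSeq F) i = {}" "Dset (FinSeq G) j \<inter> Dset (FinSeq F) i = {}"
    and e: "e \<in> set F" "g \<in> set G"
  shows "\<not> contend_on b e g"
proof -
  have ij: "i \<noteq> j" using dist by auto
  have "F \<noteq> []" using e(1) by auto
  then obtain A' where A': "fin_execution M (A' @ F @ G)" "\<forall>e\<in>set A'. txn e = k"
    "Dset (FinSeq A') k \<subseteq> Wset (FinSeq A) k"
    using hide_reads[OF inv ex A F G dist(2,3) ij _ upd] by blast
  have DA: "Dset (FinSeq A') m = {}" if "m \<noteq> k" for m using A'(2) that by (auto intro!: Dset_other)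
  have DF: "Dset (FinSeq F) m = {}" if "m \<noteq> i" for m using F that by (auto intro!: Dset_other)
  have DG: "Dset (FinSeq G) m = {}" if "m \<noteq> j" for m using G that by (auto intro!: Dset_other)
  show ?thesis
  proof (rule weak_DAP_no_contention[OF dap A'(1) F G, of "Dset (FinSeq F) i"])
    show "Dset (FinSeq (A' @ F @ G)) m \<subseteq> Dset (FinSeq F) i \<or>
        Dset (FinSeq (A' @ F @ G)) m \<inter> Dset (FinSeq F) i = {}" for m
      using A'(3) disj DA[of m] DF[of m] DG[of m] dist(2,3) ij
      by (cases "m = k"; cases "m = i"; cases "m = j") (auto simp: Dset_append)
  qed (use dist ij e disj DA DF DG in \<open>auto simp: Dset_append\<close>)
qed

section \<open>The impossibility result\<close>

lemma Dset_solo: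
  "solo k ors G \<Longrightarrow> Dset (FinSeq G) k \<subseteq>
    {X. Read X \<in> fst ` set ors \<or> (\<exists>v. Write X v \<in> fst ` set ors)}"
  by (auto simp: Dset_def Rset_FinSeq Wset_FinSeq dest: solo_Inv)

lemma solo_t_complete: "solo k (ors @ [(TryC, Commit)]) G \<Longrightarrow> t_complete (FinSeq (A @ G)) k"
  using solo_last[of k "ors @ [(TryC, Commit)]" G] sublist_of_same[of G k] solo_txn[of k _ G]
  by (auto simp: t_complete_FinSeq)

lemma rt_prec_append:
  assumes "t_complete (FinSeq A) k" "\<forall>e\<in>set B. txn e \<noteq> k" "\<forall>e\<in>set A. txn e \<noteq> m" "m \<in> txn ` set B"
  shows "rt_prec (FinSeq (A @ B)) k m"
proof -
  have "k \<in> txn ` set A" using assms(1) by (simp add: t_complete_FinSeq sublist_of_eq_Nil_iff)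
  moreover have "t_complete (FinSeq (A @ B)) k"
    using assms(1) sublist_of_other[OF assms(2)] by (simp add: t_complete_FinSeq)
  ultimately show ?thesis
    using all_before_append[OF assms(3,2)] assms(4) by (auto simp: rt_prec_def txns_FinSeq)
qed

lemma history_txn: "\<forall>e\<in>set E. txn e = k \<Longrightarrow> \<forall>e\<in>set (history E). txn e = k"
  using set_history_subset by fast

lemma reader_exists:
  assumes "M \<in> OF_class" "fin_execution M A" "k \<notin> txn ` set A"
    "\<forall>m\<in>txn ` set A. process_of m = process_of k \<longrightarrow> t_complete (FinSeq A) m"
  obtains v G where "solo k [(Read X, Val v), (TryC, Commit)] G" "fin_execution M (A @ G)"
proof -
  have "\<exists>ors G. map fst ors = [Read X, TryC] \<and> solo k ors G \<and> fin_execution M (A @ G) \<and>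
      (\<forall>(op, r)\<in>set ors. matches op r \<and> r \<noteq> Abort)"
    by (rule solo_exists) (use assms in \<open>auto intro: fin_execution.empty\<close>)
  then obtain ors G where ors: "map fst ors = [Read X, TryC]" "solo k ors G" "fin_execution M (A @ G)"
    "\<forall>(op, r)\<in>set ors. matches op r \<and> r \<noteq> Abort"
    by (elim exE conjE)
  \<comment> \<open>Without aborts, \<open>matches\<close> leaves only a value for the read and
    \<open>Commit\<close> for \<open>TryC\<close>.\<close>
  from ors(1,4) obtain v where "ors = [(Read X, Val v), (TryC, Commit)]"
    by (auto simp: map_eq_Cons_conv)
  then show ?thesis using ors(2,3) that by blast
qed

lemma writer_exists:
  assumes "M \<in> OF_class" "fin_execution M A" "k \<notin> txn ` set A"
    "\<forall>m\<in>txn ` set A. process_of m = process_of k \<longrightarrow> t_complete (FinSeq A) m"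
  obtains G where "solo k [(Write X v, Ok), (TryC, Commit)] G" "fin_execution M (A @ G)"
proof -
  have "\<exists>ors G. map fst ors = [Write X v, TryC] \<and> solo k ors G \<and> fin_execution M (A @ G) \<and>
      (\<forall>(op, r)\<in>set ors. matches op r \<and> r \<noteq> Abort)"
    by (rule solo_exists) (use assms in \<open>auto intro: fin_execution.empty\<close>)
  then obtain ors G where ors: "map fst ors = [Write X v, TryC]" "solo k ors G" "fin_execution M (A @ G)"
    "\<forall>(op, r)\<in>set ors. matches op r \<and> r \<noteq> Abort"
    by (elim exE conjE)
  from ors(1,4) have "ors = [(Write X v, Ok), (TryC, Commit)]"
    by (auto simp: map_eq_Cons_conv)
  then show ?thesis using ors(2,3) that by blast
qed

lemma updater_exists:
  assumes "M \<in> OF_class"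
  obtains z G where "solo k [(Read Z, Val z), (Write X v, Ok), (TryC, Commit)] G" "fin_execution M G"
proof -
  have "\<exists>ors G. map fst ors = [Read Z, Write X v, TryC] \<and> solo k ors G \<and> fin_execution M ([] @ G) \<and>
      (\<forall>(op, r)\<in>set ors. matches op r \<and> r \<noteq> Abort)"
    by (rule solo_exists) (use assms in \<open>auto intro: fin_execution.empty\<close>)
  then obtain ors G where ors: "map fst ors = [Read Z, Write X v, TryC]" "solo k ors G" "fin_execution M ([] @ G)"
    "\<forall>(op, r)\<in>set ors. matches op r \<and> r \<noteq> Abort"
    by (elim exE conjE)
  from ors(1,4) obtain z where "ors = [(Read Z, Val z), (Write X v, Ok), (TryC, Commit)]"
    by (auto simp: map_eq_Cons_conv)
  then show ?thesis using ors(2,3) that by (metis append_Nil)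
qed

lemma impossibility:
  fixes M :: "('p, 'x, 'v, 'b, 's, 'r, 'l) tm"
  assumes M: "M \<in> OF_class" and dap: "weak_DAP M" and ss: "strictly_serializable M"
    and inv: "invisible_reads M"
    and p: "p0 \<noteq> p1" "p0 \<noteq> p2" "p1 \<noteq> (p2 :: 'p)"
    and XZ: "X \<noteq> Z" and nv: "nv \<noteq> init_val M X" and nz: "nz \<noteq> init_val M Z"
  shows False
proof -
  \<comment> \<open>\<open>T1\<close> and \<open>T3\<close> share the process \<open>p1\<close> and
    differ by their index; \<open>T3\<close> will be t-complete before \<open>T1\<close>
    starts.\<close>
  define T0 where "T0 = (p0, 0 :: nat)"
  define T1 where "T1 = (p1, 1 :: nat)"
  define T2 where "T2 = (p2, 0 :: nat)"
  define T3 where "T3 = (p1, 0 :: nat)"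
  have T: "T0 \<noteq> T1" "T0 \<noteq> T2" "T0 \<noteq> T3" "T1 \<noteq> T2" "T1 \<noteq> T3" "T2 \<noteq> T3"
    "T1 \<noteq> T0" "T2 \<noteq> T0" "T3 \<noteq> T0" "T2 \<noteq> T1" "T3 \<noteq> T1" "T3 \<noteq> T2"
    using p by (auto simp: T0_def T1_def T2_def T3_def)
  have proc: "process_of T0 = p0" "process_of T1 = p1" "process_of T2 = p2" "process_of T3 = p1"
    by (simp_all add: T0_def T1_def T2_def T3_def)
  have ser: "strictly_serializable_history (init_val M) (history E)" if "fin_execution M E" for E
    using ss that by (simp add: strictly_serializable_def)

  \<comment> \<open>The solo run of the updater and its prefixes\<close>
  obtain z \<alpha> where \<alpha>: "solo T0 [(Read Z, Val z), (Write X nv, Ok), (TryC, Commit)] \<alpha>"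
    and ex\<alpha>: "fin_execution M \<alpha>"
    using updater_exists[OF M] by blast
  have \<alpha>_txn: "\<forall>e\<in>set \<alpha>. txn e = T0" using solo_txn[OF \<alpha>] by blast
  have \<alpha>_Inv: "m = T0 \<and> op \<in> {Read Z, Write X nv, TryC}" if "Event m (Inv op) \<in> set \<alpha>" for m op
    using solo_Inv[OF \<alpha> that] by auto
  have h\<alpha>: "history \<alpha> = [Event T0 (Inv (Read Z)), Event T0 (Resp (Val z)),
      Event T0 (Inv (Write X nv)), Event T0 (Resp Ok), Event T0 (Inv TryC), Event T0 (Resp Commit)]"
    using history_solo[OF \<alpha>] by simp

  \<comment> \<open>Nothing in this history writes to \<open>Z\<close>.\<close>
  have z: "z = init_val M Z"
  proof -
    obtain C prec where so: "serial_order (init_val M) (history \<alpha>) C prec"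
      using serialization[OF ser[OF ex\<alpha>]] by blast
    note C = serial_order.committed_in[OF so]
      and rd = serial_order.first_read[OF so]
    have "T0 \<in> C" by (rule C) (simp add: committed_FinSeq h\<alpha>)
    from rd[OF this, of Z z] show ?thesis using XZ by (simp add: h\<alpha>)
  qed

  define A where "A i = take i \<alpha>" for i
  have A_sub: "set (A i) \<subseteq> set \<alpha>" for i by (simp add: A_def set_take_subset)
  then have A_txn: "\<forall>e\<in>set (A i). txn e = T0" for i using \<alpha>_txn by blast
  have exA: "fin_execution M (A i)" for i
    using ex\<alpha> fin_execution_appendD[of M "take i \<alpha>" "drop i \<alpha>"] by (simp add: A_def)
  have A_Wset: "Wset (FinSeq (A i)) T0 \<subseteq> {X}" for i
    using A_sub[of i] by (auto simp: Wset_FinSeq dest!: subsetD \<alpha>_Inv)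
  \<comment> \<open>The invocation of the read of \<open>Z\<close> is the very first event, so every
    nonempty prefix has a read to be hidden.\<close>
  have A_Rset: "Rset (FinSeq (A i)) T0 \<noteq> {}" if "A i \<noteq> []" for i
  proof -
    have "i \<noteq> 0" using that by (auto simp: A_def)
    then obtain i' where i': "i = Suc i'" using not0_implies_Suc by blast
    have "Event T0 (Inv (Read Z)) \<in> set (A i)" using \<alpha> by (auto simp: A_def i')
    then show ?thesis by (auto simp: Rset_FinSeq)
  qed

  define writer where "writer G \<longleftrightarrow> solo T3 [(Write Z nz, Ok), (TryC, Commit)] G"
    for G :: "('p, 'x, 'v, 'b, 's, 'r) event list"
  define reader where "reader k v G \<longleftrightarrow> solo k [(Read X, Val v), (TryC, Commit)] G"
    for k v and G :: "('p, 'x, 'v, 'b, 's, 'r) event list"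
  have writer_txn: "\<forall>e\<in>set G. txn e = T3" if "writer G" for G
    using that solo_txn unfolding writer_def by blast
  have reader_txn: "\<forall>e\<in>set G. txn e = k" if "reader k v G" for k v G
    using that solo_txn unfolding reader_def by blast
  have writer_Inv: "m = T3 \<and> op \<in> {Write Z nz, TryC}"
    if "writer G" "Event m (Inv op) \<in> set G" for G m op
    using that solo_Inv unfolding writer_def by fastforce
  have reader_Inv: "m = k \<and> op \<in> {Read X, TryC}"
    if "reader k v G" "Event m (Inv op) \<in> set G" for k v G m op
    using that solo_Inv unfolding reader_def by fastforce
  have hwriter: "history G = [Event T3 (Inv (Write Z nz)), Event T3 (Resp Ok),
      Event T3 (Inv TryC), Event T3 (Resp Commit)]" if "writer G" for G
    using that history_solo unfolding writer_def by fastforce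
  have hreader: "history G = [Event k (Inv (Read X)), Event k (Resp (Val v)),
      Event k (Inv TryC), Event k (Resp Commit)]" if "reader k v G" for k v G
    using that history_solo unfolding reader_def by fastforce
  have writer_Dset: "Dset (FinSeq G) T3 \<subseteq> {Z}" if "writer G" for G
    using Dset_solo that unfolding writer_def by fastforce
  have reader_Dset: "Dset (FinSeq G) k \<subseteq> {X}" if "reader k v G" for k v G
    using Dset_solo that unfolding reader_def by fastforce
  have reader_trivial: "\<forall>e\<in>set G. \<not> changes b e"
    if G: "reader k v G" and ex: "fin_execution M (E @ G)" and E: "\<forall>e\<in>set E. txn e \<noteq> k" for b k v G E
  proof -
    have "Event k (Inv (Write Y w)) \<notin> set (E @ G)" for Y w
      using E reader_Inv[OF G, of k "Write Y w"] by (auto dest: bspec)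
    then have "Wset (FinSeq (E @ G)) k = {}" by (simp add: Wset_FinSeq)
    then have "\<not> nontrivial e" if "e \<in> set G" for e
      using read_only_trivial[OF inv ex] reader_txn[OF G] that by simp
    then show ?thesis by (simp add: changes_def)
  qed

  \<comment> \<open>The critical step of the updater\<close>
  define P where "P i \<longleftrightarrow> (\<exists>E3 E2 w. writer E3 \<and> reader T2 w E2 \<and> w \<noteq> init_val M X \<and>
    fin_execution M (A i @ E3 @ E2))" for i
  \<comment> \<open>Because a run exists for every prefix, the failure of \<open>P i\<close> yields
    an actual run in which \<open>T2\<close> reads the initial value.\<close>
  have exists: "\<exists>E3 E2 w. writer E3 \<and> reader T2 w E2 \<and> fin_execution M (A i @ E3 @ E2)" for i
  proof -
    have "T3 \<notin> txn ` set (A i)"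
      "\<forall>m\<in>txn ` set (A i). process_of m = process_of T3 \<longrightarrow> t_complete (FinSeq (A i)) m"
      using A_txn[of i] T proc p by auto
    from writer_exists[OF M exA this] obtain E3 where E3: "writer E3" "fin_execution M (A i @ E3)"
      unfolding writer_def .
    have "T2 \<notin> txn ` set (A i @ E3)" "\<forall>m\<in>txn ` set (A i @ E3).
        process_of m = process_of T2 \<longrightarrow> t_complete (FinSeq (A i @ E3)) m"
      using A_txn[of i] writer_txn[OF E3(1)] T proc p by auto
    from reader_exists[OF M E3(2) this] obtain w E2
      where "reader T2 w E2" "fin_execution M ((A i @ E3) @ E2)"
      unfolding reader_def .
    then show ?thesis using E3 by auto
  qed

  \<comment> \<open>Without \<open>T0\<close> there is no write to \<open>X\<close> that
    \<open>T2\<close> could have read.\<close>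
  have "\<not> P 0"
  proof
    assume "P 0"
    then obtain E3 E2 w where E: "writer E3" "reader T2 w E2" "w \<noteq> init_val M X" "fin_execution M (E3 @ E2)"
      unfolding P_def A_def by auto
    define H where "H = history (E3 @ E2)"
    obtain C prec where so: "serial_order (init_val M) H C prec"
      using serialization[OF ser[OF E(4)]] unfolding H_def by blast
    note C = serial_order.committed_in[OF so]
      and rd = serial_order.first_read[OF so]
    have H: "H = history E3 @ history E2" by (simp add: H_def)
    have "T2 \<in> C" by (rule C) (simp add: committed_FinSeq H hwriter[OF E(1)] hreader[OF E(2)] T)
    from rd[OF this, of X w] show False
      using E(3) XZ by (simp add: H hwriter[OF E(1)] hreader[OF E(2)] T)
  qed
  \<comment> \<open>\<open>T0\<close> has committed before \<open>T2\<close> starts, so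
    \<open>T2\<close> must read a written value, and \<open>nv\<close> is the only value written to
    \<open>X\<close>.\<close>
  moreover have "P (length \<alpha>)"
  proof -
    obtain E3 E2 w where E: "writer E3" "reader T2 w E2" "fin_execution M (\<alpha> @ E3 @ E2)"
      using exists[of "length \<alpha>"] by (auto simp: A_def)
    define H where "H = history (\<alpha> @ E3 @ E2)"
    obtain C prec where so: "serial_order (init_val M) H C prec"
      using serialization[OF ser[OF E(3)]] unfolding H_def by blast
    note C = serial_order.committed_in[OF so]
      and rt = serial_order.real_time[OF so]
      and rd = serial_order.first_read[OF so]
    have H: "H = history \<alpha> @ history E3 @ history E2" by (simp add: H_def)
    note h = H hwriter[OF E(1)] hreader[OF E(2)] h\<alpha>
    have T2: "T2 \<in> C" by (rule C) (simp add: committed_FinSeq h T)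
    have T0: "T0 \<in> C" by (rule C) (simp add: committed_FinSeq h T)
    have "rt_prec (FinSeq H) T0 T2" unfolding H
      by (rule rt_prec_append) (simp_all add: h T t_complete_FinSeq)
    then have "prec T0 T2" using rt T0 T2 by blast
    then have "\<exists>m\<in>C. \<exists>w. prec m T2 \<and> Event m (Inv (Write X w)) \<in> set H" using T0 by (auto simp: h)
    then have "\<exists>m\<in>C. Event m (Inv (Write X w)) \<in> set H"
      using rd[OF T2, of X w] by (auto simp: h T)
    then have "w = nv" using XZ by (auto simp: h)
    then show ?thesis unfolding P_def using E nv by (auto simp: A_def)
  qed
  ultimately obtain j where j: "j < length \<alpha>" "\<not> P j" "P (Suc j)"
    using ex_least_nat_less[of P "length \<alpha>"] by blast
  define e where "e = \<alpha> ! j"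
  have Suc_j: "A (Suc j) = A j @ [e]" using j(1) by (simp add: A_def e_def take_Suc_conv_app_nth)
  have e_txn: "txn e = T0" using A_txn[of "Suc j"] Suc_j by simp
  obtain E3 E2 w where E3: "writer E3" and E2: "reader T2 w E2" and w: "w \<noteq> init_val M X"
    and ex1: "fin_execution M ((A j @ [e]) @ E3 @ E2)"
    using j(3) unfolding P_def Suc_j by blast

  have ex2: "\<exists>E2'. reader T2 (init_val M X) E2' \<and> fin_execution M (A j @ E3 @ E2')"
  proof -
    obtain E3' E2' w' where E: "writer E3'" "reader T2 w' E2'" "fin_execution M (A j @ E3' @ E2')"
      using exists by blast
    \<comment> \<open>The runs of \<open>T3\<close> before and after \<open>e\<close> are both runs
      from the initial configuration, and hence coincide by determinism.\<close>
    have init: "fin_execution M G" if "writer G" "fin_execution M (A i @ G)" for i G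
      using run_from_initial_configuration[OF dap inv that(2) A_txn writer_txn[OF that(1)]]
        A_Rset A_Wset[of i] writer_Dset[OF that(1)] proc p XZ by auto
    have "fin_execution M ((A j @ [e]) @ E3)" "fin_execution M (A j @ E3')"
      using ex1 E(3) fin_execution_appendD[of M "(A j @ [e]) @ E3" E2]
        fin_execution_appendD[of M "A j @ E3'" E2'] by simp_all
    then have "fin_execution M ([] @ E3)" "fin_execution M ([] @ E3')"
      using init E(1) E3 Suc_j by (metis append_Nil)+
    then have "E3' = E3" using solo_deterministic E(1) E3 unfolding writer_def by blast
    moreover have "w' = init_val M X" using E j(2) unfolding P_def by blast
    ultimately show ?thesis using E by blast
  qed
  then obtain E2' where E2': "reader T2 (init_val M X) E2'" "fin_execution M (A j @ E3 @ E2')" by blast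
  have ex3: "fin_execution M (A j @ E3)"
    using E2'(2) fin_execution_appendD[of M "A j @ E3" E2'] by simp

  \<comment> \<open>A further reader behind the writer of \<open>Z\<close>\<close>
  obtain v E1 where E1: "reader T1 v E1" "fin_execution M ((A j @ E3) @ E1)"
  proof -
    have T3: "t_complete (FinSeq (A j @ E3)) T3"
      using solo_t_complete[of T3 "[(Write Z nz, Ok)]" E3] E3 by (simp add: writer_def)
    have "T1 \<notin> txn ` set (A j @ E3)" "\<forall>m\<in>txn ` set (A j @ E3).
        process_of m = process_of T1 \<longrightarrow> t_complete (FinSeq (A j @ E3)) m"
      using A_txn[of j] writer_txn[OF E3] T3 T proc p by auto
    from reader_exists[OF M ex3 this] show ?thesis
      using that unfolding reader_def .
  qed
  have E1_trivial: "\<forall>e\<in>set E1. \<not> changes b e" for b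
    by (rule reader_trivial[OF E1]) (use A_txn[of j] writer_txn[OF E3] T in auto)
  note txns = A_txn[of j] e_txn writer_txn[OF E3] reader_txn[OF E1(1)] reader_txn[OF E2] reader_txn[OF E2'(1)]
  have no_events: "at_process p0 E1 = []" "at_process p0 E3 = []" "at_process p2 E1 = []"
    "at_process p2 [e] = []" "at_process p2 (A j) = []" "at_process p2 E3 = []"
    using txns proc p by (auto intro!: at_process_other)

  \<comment> \<open>If \<open>T1\<close> read another value, \<open>T2\<close> could still follow
    with \<open>E2'\<close>, because \<open>T1\<close> changes no base object. A write seen by
    \<open>T1\<close> would then be serialized before \<open>T2\<close>, which nevertheless returns
    the initial value although only \<open>nv\<close> is ever written to \<open>X\<close>.\<close>
  have v: "v = init_val M X"
  proof (rule ccontr)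
    assume v: "v \<noteq> init_val M X"
    have ex: "fin_execution M (((A j @ E3) @ E1) @ E2')"
    proof (rule fin_execution_transfer[where p = p2])
      show "fin_execution M ((A j @ E3) @ E2')" using E2'(2) by simp
      show "fin_execution M ((A j @ E3) @ E1)" by (fact E1(2))
      show "\<forall>e\<in>set E2'. process_of (txn e) = p2" using txns proc by simp
      show "at_process p2 (A j @ E3) = at_process p2 ((A j @ E3) @ E1)" using no_events by simp
      show "\<forall>e\<in>set E2'. \<forall>b. on_object b e \<longrightarrow>
          base_after M (A j @ E3) b = base_after M ((A j @ E3) @ E1) b"
        by (simp only: base_after_append_unchanged[OF E1_trivial]) simp
    qed
    define H where "H = history (((A j @ E3) @ E1) @ E2')"
    obtain C prec where so: "serial_order (init_val M) H C prec"
      using serialization[OF ser[OF ex]] unfolding H_def by blast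
    note C = serial_order.committed_in[OF so]
      and trans = serial_order.trans[OF so]
      and rt = serial_order.real_time[OF so]
      and rd = serial_order.first_read[OF so]
    have H: "H = (history (A j) @ history E3 @ history E1) @ history E2'" by (simp add: H_def)
    note h = H hwriter[OF E3] hreader[OF E1(1)] hreader[OF E2'(1)]
    have hA: "sublist_of (history (A j)) m = []" if "m \<noteq> T0" for m
      using history_txn[OF txns(1)] that by (intro sublist_of_other) auto
    have hA2: "txn e = T0" if "e \<in> set (history (A j))" for e using history_txn[OF txns(1)] that by blast
    have T1: "T1 \<in> C" by (rule C) (simp add: committed_FinSeq h T hA)
    have T2: "T2 \<in> C" by (rule C) (simp add: committed_FinSeq h T hA)
    have "rt_prec (FinSeq H) T1 T2" unfolding H
      by (rule rt_prec_append) (use hA2 in \<open>auto simp: h T hA t_complete_FinSeq\<close>)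
    then have 12: "prec T1 T2" using rt T1 T2 by blast
    have X_writes: "u = nv" if "Event m (Inv (Write X u)) \<in> set H" for m u
      using that XZ A_sub[of j] set_history_subset[of "A j"] \<alpha>_Inv[of m "Write X u"] by (auto simp: h)
    obtain m where "m \<in> C" "prec m T1" "Event m (Inv (Write X v)) \<in> set H"
      using rd[OF T1, of X v] v by (auto simp: h T hA)
    then have "\<exists>m\<in>C. \<exists>w. prec m T2 \<and> Event m (Inv (Write X w)) \<in> set H" using trans 12 by blast
    then obtain m where "Event m (Inv (Write X (init_val M X))) \<in> set H"
      using rd[OF T2, of X "init_val M X"] by (auto simp: h T hA)
    then show False using X_writes nv by metis
  qed

  \<comment> \<open>Otherwise \<open>T2\<close> could not tell whether \<open>e\<close> has occurred
    and would read \<open>w\<close> without it, so that \<open>P j\<close> would hold.\<close>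
  have "\<exists>b g. changes b e \<and> g \<in> set E2 \<and> on_object b g"
  proof (rule ccontr)
    assume "\<not> ?thesis"
    then have unchanged: "\<not> changes b e" if "g \<in> set E2" "on_object b g" for b g using that by blast
    have "fin_execution M ((A j @ E3) @ E2)"
    proof (rule fin_execution_transfer[where p = p2])
      show "fin_execution M (((A j @ [e]) @ E3) @ E2)" using ex1 by simp
      show "\<forall>e\<in>set E2. process_of (txn e) = p2" using txns proc by simp
      show "at_process p2 ((A j @ [e]) @ E3) = at_process p2 (A j @ E3)"
        by (simp only: at_process_append no_events append_Nil)
      show "\<forall>g\<in>set E2. \<forall>b. on_object b g \<longrightarrow>
          base_after M ((A j @ [e]) @ E3) b = base_after M (A j @ E3) b"
      proof (intro ballI allI impI)
        fix g b assume "g \<in> set E2" "on_object b g"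
        then have "base_after M (A j @ [e]) b = base_after M (A j) b"
          using unchanged by (intro base_after_append_unchanged) auto
        then show "base_after M ((A j @ [e]) @ E3) b = base_after M (A j @ E3) b"
          by (rule base_after_append_cong)
      qed
    qed (fact ex3)
    then have "P j" unfolding P_def using E3 E2 w by auto
    then show False using j(2) by blast
  qed
  then obtain b g where b: "changes b e" and g: "g \<in> set E2" "on_object b g" by blast

  have E3_unchanged: "\<forall>f\<in>set E3. \<not> changes b f"
  proof
    fix f assume f: "f \<in> set E3"
    \<comment> \<open>Since \<open>e\<close> is nontrivial, \<open>T0\<close> is no longer read-only
      and has already invoked its write. This is what allows its reads to be hidden.\<close>
    have "nontrivial e" using b by (simp add: changes_def)
    then have Wset: "Wset (FinSeq (A j @ [e])) T0 \<noteq> {}"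
      using read_only_trivial[OF inv exA[of "Suc j"], of T0 e] Suc_j e_txn by auto
    have "\<not> contend_on b f g"
    proof (rule no_contention_behind_updater[OF dap inv ex1 _ txns(3,5)])
      show "Rset (FinSeq (A j @ [e])) T0 \<noteq> {}" using A_Rset[of "Suc j"] Suc_j by simp
      show "Wset (FinSeq (A j @ [e])) T0 \<inter> Dset (FinSeq E3) T3 = {}"
        using A_Wset[of "Suc j"] writer_Dset[OF E3] XZ unfolding Suc_j by auto
      show "Dset (FinSeq E2) T2 \<inter> Dset (FinSeq E3) T3 = {}"
        using reader_Dset[OF E2] writer_Dset[OF E3] XZ by auto
    qed (use Wset f g(1) proc p T txns in auto)
    then show "\<not> changes b f" using g(2) by (auto simp: contend_on_iff changes_def)
  qed

  \<comment> \<open>Postponing the critical step behind the writer and the first reader\<close>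
  define E where "E = ((A j @ E3) @ E1) @ [e]"
  have base_e: "base_after M (A j) b = base_after M ((A j @ E3) @ E1) b"
    using base_after_append_unchanged[OF E1_trivial, of M "A j @ E3" b]
      base_after_append_unchanged[OF E3_unchanged, of M "A j"] by simp
  have ex4: "fin_execution M E" unfolding E_def
  proof (rule fin_execution_transfer[where p = p0])
    show "fin_execution M (A j @ [e])" using exA[of "Suc j"] Suc_j by simp
    show "fin_execution M ((A j @ E3) @ E1)" by (fact E1(2))
    show "at_process p0 (A j) = at_process p0 ((A j @ E3) @ E1)" using no_events by simp
    \<comment> \<open>\<open>e\<close> accesses no other object, so agreement on \<open>b\<close> is
      enough for its response to be the same.\<close>
    have "c = b" if "on_object c e" for c
      using that b by (auto simp: changes_def on_object_def)
    then show "\<forall>e\<in>set [e]. \<forall>b. on_object b e \<longrightarrow>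
        base_after M (A j) b = base_after M ((A j @ E3) @ E1) b" using base_e by auto
  qed (use txns proc in simp)
  have ex5: "fin_execution M (E @ E2)"
  proof (rule fin_execution_transfer[where p = p2])
    show "fin_execution M (((A j @ [e]) @ E3) @ E2)" using ex1 by simp
    show "\<forall>e\<in>set E2. process_of (txn e) = p2" using txns proc by simp
    show "at_process p2 ((A j @ [e]) @ E3) = at_process p2 E"
      by (simp only: E_def at_process_append no_events append_Nil)
    \<comment> \<open>\<open>T3\<close> does not change \<open>b\<close>, \<open>e\<close> changes
      nothing else, and \<open>T1\<close> changes nothing at all. So swapping \<open>e\<close> with
      \<open>E3\<close> and inserting \<open>E1\<close> leaves every object with the same
      value.\<close>
    have "base_after M ((A j @ [e]) @ E3) c = base_after M E c" for c
    proof (cases "c = b")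
      case True
      have "base_after M ((A j @ [e]) @ E3) b = base_after M (A j @ [e]) b"
        by (rule base_after_append_unchanged[OF E3_unchanged])
      also have "\<dots> = base_after M E b"
        unfolding E_def by (rule base_after_append_cong[OF base_e])
      finally show ?thesis using True by simp
    next
      case False
      then have e: "\<forall>x\<in>set [e]. \<not> changes c x"
        using b by (auto simp: changes_def on_object_def)
      have "base_after M ((A j @ [e]) @ E3) c = base_after M (A j @ E3) c"
        by (rule base_after_append_cong) (rule base_after_append_unchanged[OF e])
      also have "\<dots> = base_after M E c"
        unfolding E_def base_after_append_unchanged[OF e] base_after_append_unchanged[OF E1_trivial] ..
      finally show ?thesis .
    qed
    then show "\<forall>g\<in>set E2. \<forall>b. on_object b g \<longrightarrow>
        base_after M ((A j @ [e]) @ E3) b = base_after M E b" by blast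
  qed (fact ex4)

  \<comment> \<open>The contradiction in the serial order\<close>
  define H where "H = history (E @ E2)"
  obtain C prec where so: "serial_order (init_val M) H C prec"
    using serialization[OF ser[OF ex5]] unfolding H_def by blast
  note C = serial_order.committed_in[OF so]
    and total = serial_order.total[OF so]
    and trans = serial_order.trans[OF so]
    and rt = serial_order.real_time[OF so]
    and rd = serial_order.first_read[OF so]
  have H: "H = (history (A j) @ history E3) @ history E1 @ history [e] @ history E2"
    by (simp only: H_def E_def history_append append_assoc)
  note h = H hwriter[OF E3] hreader[OF E1(1)] hreader[OF E2]
  have hA_txn: "\<forall>x\<in>set (history (A j)). txn x = T0" "\<forall>x\<in>set (history [e]). txn x = T0"
    using history_txn[OF txns(1)] history_txn[of "[e]" T0] e_txn by simp_all
  have hA: "sublist_of (history (A j)) m = []" "sublist_of (history [e]) m = []" if "m \<noteq> T0" for m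
    using hA_txn that by (auto intro!: sublist_of_other)
  have hT0: "sublist_of H T0 = history (A j @ [e])"
    using sublist_of_same[OF hA_txn(1)] sublist_of_same[OF hA_txn(2)] by (simp add: h T)
  have writes: "m = T0 \<and> Y = X \<and> u = nv \<or> m = T3 \<and> Y = Z \<and> u = nz"
    if "Event m (Inv (Write Y u)) \<in> set H" for m Y u
    using that A_sub[of "Suc j"] set_history_subset[of "A j"] set_history_subset[of "[e]"]
      \<alpha>_Inv[of m "Write Y u"] unfolding Suc_j by (auto simp: h)
  have T1: "T1 \<in> C" and T2: "T2 \<in> C" and T3: "T3 \<in> C"
    by (rule C; simp add: committed_FinSeq h T hA)+

  \<comment> \<open>\<open>T2\<close> reads a value that is not initial, so some transaction in
    \<open>C\<close> wrote it. Only \<open>T0\<close> writes to \<open>X\<close>; hence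
    \<open>T0\<close> is serialized although it need not have committed in \<open>H\<close>.\<close>
  obtain m where m: "m \<in> C" "Event m (Inv (Write X w)) \<in> set H"
    using rd[OF T2, of X w] w by (auto simp: h T hA)
  then have T0: "T0 \<in> C" and wX: "Event T0 (Inv (Write X nv)) \<in> set H" using writes[OF m(2)] XZ by auto
  then have "Event T0 (Inv (Write X nv)) \<in> set (history (A j @ [e]))"
    by (auto simp: h T)
  then have inA: "Event T0 (Inv (Write X nv)) \<in> set (take (Suc j) \<alpha>)"
    using set_history_subset Suc_j A_def by (metis subsetD)
  have "\<exists>rest. history (A j @ [e]) = Event T0 (Inv (Read Z)) # Event T0 (Resp (Val z)) # rest"
  proof -
    obtain F V where F: "rmws T0 F" and V: "\<alpha> = (Event T0 (Inv (Read Z)) # F @ [Event T0 (Resp (Val z))]) @ V"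
      using \<alpha> by auto
    define U where "U = Event T0 (Inv (Read Z)) # F @ [Event T0 (Resp (Val z))]"
    have "Event T0 (Inv (Write X nv)) \<notin> set U" using F by (auto simp: U_def rmws_def)
    moreover have "\<alpha> = U @ V" using V U_def by simp
    \<comment> \<open>A prefix ending inside \<open>U\<close> would lack the write invocation, as
      \<open>U\<close> consists of the read of \<open>Z\<close> alone. So this read is complete in
      the prefix.\<close>
    ultimately have "length U \<le> Suc j" using inA
      by (metis append_Nil2 diff_is_0_eq in_set_takeD nat_le_linear take0 take_append)
    then have "A (Suc j) = U @ take (Suc j - length U) V"
      unfolding A_def \<open>\<alpha> = U @ V\<close> by (simp add: take_all)
    then have "A j @ [e] = U @ take (Suc j - length U) V" by (simp only: Suc_j)
    then show ?thesis by (simp add: U_def history_Cons history_rmws[OF F])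
  qed
  then obtain rest where rest: "sublist_of H T0 = Event T0 (Inv (Read Z)) # Event T0 (Resp (Val z)) # rest"
    using hT0 by auto
  have wZ: "Event T3 (Inv (Write Z nz)) \<in> set H" by (simp add: h)
  \<comment> \<open>\<open>T0\<close> read the initial value of \<open>Z\<close>, while the only
    value ever written to \<open>Z\<close> is \<open>nz\<close>; so no writer of \<open>Z\<close>
    precedes it.\<close>
  have "\<not> prec T3 T0"
    using rd[OF T0 rest] T3 wZ writes[of _ Z z] z nz XZ by blast
  then have "prec T0 T3" using total[OF T0 T3] T by blast
  moreover have "rt_prec (FinSeq H) T3 T1" unfolding H
    by (rule rt_prec_append) (use hA_txn in \<open>auto simp: h T hA t_complete_FinSeq\<close>)
  then have "prec T3 T1" using rt T1 T3 by blast
  ultimately have "prec T0 T1" using trans by blast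
  moreover have "sublist_of H T1 = Event T1 (Inv (Read X)) # Event T1 (Resp (Val v)) #
      [Event T1 (Inv TryC), Event T1 (Resp Commit)]"
    by (simp add: h T hA)
  \<comment> \<open>\<open>T0\<close> precedes \<open>T1\<close> and writes to \<open>X\<close>, so
    \<open>T1\<close> would have to return the written value \<open>nv\<close>, but it returns the
    initial one.\<close>
  ultimately show False
    using rd[OF T1, of X v] T0 wX writes[of _ X v] v nv XZ by blast
qed

theorem theorem2:
  assumes "CARD('p::finite) \<ge> 3"
    and "\<exists>X Z :: 'x. X \<noteq> Z"
    and "\<exists>v w :: 'v. v \<noteq> w"
  shows "\<not> (\<exists>M \<in> (OF_class :: ('p, 'x, 'v, 'b, 's, 'r, 'l) tm set).
    weak_DAP M \<and> strictly_serializable M \<and> invisible_reads M)"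
proof
  assume "\<exists>M \<in> (OF_class :: ('p, 'x, 'v, 'b, 's, 'r, 'l) tm set).
    weak_DAP M \<and> strictly_serializable M \<and> invisible_reads M"
  then obtain M :: "('p, 'x, 'v, 'b, 's, 'r, 'l) tm" where M: "M \<in> OF_class"
    "weak_DAP M" "strictly_serializable M" "invisible_reads M" by blast
  obtain S :: "'p set" where "card S = 3"
    using obtain_subset_with_card_n[OF assms(1)] by blast
  then obtain p0 p1 p2 :: 'p where "p0 \<noteq> p1" "p0 \<noteq> p2" "p1 \<noteq> p2" by (auto simp: card_3_iff)
  moreover obtain X Z :: 'x where "X \<noteq> Z" using assms(2) by blast
  moreover obtain nv nz where "nv \<noteq> init_val M X" "nz \<noteq> init_val M Z"
    using assms(3) by metis
  ultimately show False by (rule impossibility[OF M])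
qed

end
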